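(* Let $p$ be a prime, $S$ a finite $p$-group and $B\trianglelefteq S$. If $p=2$, assume that $B$ is abelian. Let $A\leq S$ be an abelian subgroup that contains $[B,B]$. Then either $B$ normalizes $A$, or there exists $b\in N_B(N_S(A))\setminus N_B(A)$. For any such $b$, the subgroup $A^*:=(A\cap A^b)[A,b]\leq AA^b$ has the following properties: (i) $|A^*|=|A|$. (ii) $A^*$ is abelian and contains $[B,B]$. (iii) $A^*\cap B$ strictly contains $A\cap B$ and is a proper subgroup of $B$. (iv) $A^*$ and $A$ normalize each other. (v) $N_S(A^* )$ contains $b$ and strictly contains $N_S(A)$. (vi) If $p>2$, then $\omega_i(A^* )\geq\omega_i(A)$ for all $i\geq1$. In particular, $\mathrm{exponent}(A^* )\leq\mathrm{exponent}(A)$, $\mathrm{rank}(A^* )\geq\mathrm{rank}(A)$ and $A^*\geq_{\mathrm{lex}}A$.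
   Context: All groups are finite. Conventions: $w^x=x^{-1}wx$, $[w,x]=w^{-1}x^{-1}wx$, $A^b=b^{-1}Ab$, and $[A,b]$ is the subgroup generated by all $[a,b]$ with $a\in A$. For subgroups $X,Y\leq S$, $N_X(Y)=\{x\in X: Y^x=Y\}$. For an abelian $p$-group $A$, $\Omega_i(A)$ is the subgroup generated by all elements of order $\leq p^i$ and $\omega_i(A):=|\Omega_i(A)|$. The rank of an abelian group is the size of its smallest generating set. For abelian $p$-groups $A,A'$, $A\geq_{\mathrm{lex}}A'$ means that the sequence $(\omega_1(A),\omega_2(A),\dots)$ is greater than or equal to $(\omega_1(A'),\omega_2(A'),\dots)$ in the usual lexicographic order. *)

theory Defs
  imports
    "HOL-Algebra.Group_Action"
    "HOL-Algebra.Generated_Groups"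
    "HOL-Algebra.Multiplicative_Group"
    "HOL-Library.Fun_Lexorder"
    "HOL-Computational_Algebra.Primes"
begin

text \<open>
  All notions below take subgroups as subsets \<open>A\<close> of an ambient group \<open>G\<close>. Conjugation acts on
  the right: \<open>a\<^sup>b = b\<^sup>-\<^sup>1ab\<close> and \<open>[a,b] = a\<^sup>-\<^sup>1b\<^sup>-\<^sup>1ab\<close>.
\<close>

definition conj_set :: "('a, 'b) monoid_scheme \<Rightarrow> 'a set \<Rightarrow> 'a \<Rightarrow> 'a set" where
  "conj_set G A b = (\<lambda>a. inv\<^bsub>G\<^esub> b \<otimes>\<^bsub>G\<^esub> a \<otimes>\<^bsub>G\<^esub> b) ` A"

definition commutator :: "('a, 'b) monoid_scheme \<Rightarrow> 'a \<Rightarrow> 'a \<Rightarrow> 'a" where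
  "commutator G w x = inv\<^bsub>G\<^esub> w \<otimes>\<^bsub>G\<^esub> inv\<^bsub>G\<^esub> x \<otimes>\<^bsub>G\<^esub> w \<otimes>\<^bsub>G\<^esub> x"

definition commutator_subgroup :: "('a, 'b) monoid_scheme \<Rightarrow> 'a set \<Rightarrow> 'a \<Rightarrow> 'a set" where
  "commutator_subgroup G A b = generate G ((\<lambda>a. commutator G a b) ` A)"

text \<open>The relative normalizer \<open>N\<^sub>X(Y)\<close>.\<close>

definition normalizer_in :: "('a, 'b) monoid_scheme \<Rightarrow> 'a set \<Rightarrow> 'a set \<Rightarrow> 'a set" where
  "normalizer_in G X Y = {x \<in> X. conj_set G Y x = Y}"

definition normalizes :: "('a, 'b) monoid_scheme \<Rightarrow> 'a set \<Rightarrow> 'a set \<Rightarrow> bool" where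
  "normalizes G X Y \<longleftrightarrow> (\<forall>x\<in>X. conj_set G Y x = Y)"

text \<open>The subgroup \<open>A\<^sup>* = (A \<inter> A\<^sup>b)[A,b]\<close>; a priori it is only a product set.\<close>

definition star_subgroup :: "('a, 'b) monoid_scheme \<Rightarrow> 'a set \<Rightarrow> 'a \<Rightarrow> 'a set" where
  "star_subgroup G A b = (A \<inter> conj_set G A b) <#>\<^bsub>G\<^esub> commutator_subgroup G A b"

definition Omega :: "('a, 'b) monoid_scheme \<Rightarrow> nat \<Rightarrow> nat \<Rightarrow> 'a set \<Rightarrow> 'a set" where
  "Omega G p i A = generate G {a \<in> A. group.ord G a \<le> p ^ i}"

definition omega :: "('a, 'b) monoid_scheme \<Rightarrow> nat \<Rightarrow> nat \<Rightarrow> 'a set \<Rightarrow> nat" where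
  "omega G p i A = card (Omega G p i A)"

text \<open>
  The relation \<open>A \<ge>\<^sub>l\<^sub>e\<^sub>x A'\<close>. The sequences compared start at index 1, hence the shift by \<open>Suc\<close>.
\<close>

definition lex_ge ::
    "('a, 'b) monoid_scheme \<Rightarrow> nat \<Rightarrow> 'a set \<Rightarrow> 'a set \<Rightarrow> bool" where
  "lex_ge G p A A' \<longleftrightarrow>
     (\<lambda>i. omega G p (Suc i) A) = (\<lambda>i. omega G p (Suc i) A') \<or>
     less_fun (\<lambda>i. omega G p (Suc i) A') (\<lambda>i. omega G p (Suc i) A)"

definition group_exponent :: "('a, 'b) monoid_scheme \<Rightarrow> 'a set \<Rightarrow> nat" where
  "group_exponent G A = (LEAST n. 0 < n \<and> (\<forall>a\<in>A. a [^]\<^bsub>G\<^esub> n = \<one>\<^bsub>G\<^esub>))"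

definition group_rank :: "('a, 'b) monoid_scheme \<Rightarrow> 'a set \<Rightarrow> nat" where
  "group_rank G A = (LEAST k. \<exists>X\<subseteq>A. finite X \<and> card X = k \<and> generate G X = A)"

text \<open>
  The library's \<^const>\<open>normalizer\<close> conjugates by \<open>g\<^sup>-\<^sup>1\<close> instead of \<open>g\<close>; the resulting subgroup is the same.
\<close>

lemma (in group) normalizer_in_eq_normalizer:
  assumes X: "X \<subseteq> carrier G" and Y: "Y \<subseteq> carrier G"
  shows "normalizer_in G X Y = X \<inter> normalizer G Y"
proof -
  have eq: "g <# Y #> inv g = (\<lambda>y. g \<otimes> y \<otimes> inv g) ` Y" for g
    by (auto simp: l_coset_def r_coset_def)
  have mem: "conj_set G Y x = Y \<longleftrightarrow> (\<lambda>y. x \<otimes> y \<otimes> inv x) ` Y = Y" if x: "x \<in> carrier G" for x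
  proof
    assume "conj_set G Y x = Y"
    then have "(\<lambda>y. x \<otimes> y \<otimes> inv x) ` Y
        = (\<lambda>y. x \<otimes> (inv x \<otimes> y \<otimes> x) \<otimes> inv x) ` Y"
      by (metis (mono_tags, lifting) conj_set_def image_cong image_image)
    also have "\<dots> = (\<lambda>y. y) ` Y"
      using x Y by (intro image_cong) (auto simp: m_assoc[symmetric] subset_iff,
        simp add: m_assoc)
    finally show "(\<lambda>y. x \<otimes> y \<otimes> inv x) ` Y = Y" by simp
  next
    assume "(\<lambda>y. x \<otimes> y \<otimes> inv x) ` Y = Y"
    then have "conj_set G Y x = (\<lambda>y. inv x \<otimes> (x \<otimes> y \<otimes> inv x) \<otimes> x) ` Y"
      unfolding conj_set_def by (metis (mono_tags, lifting) image_cong image_image)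
    also have "\<dots> = (\<lambda>y. y) ` Y"
      using x Y by (intro image_cong) (auto simp: m_assoc[symmetric] subset_iff,
        simp add: m_assoc)
    finally show "conj_set G Y x = Y" by simp
  qed
  have norm: "normalizer G Y = {x \<in> carrier G. (\<lambda>y. x \<otimes> y \<otimes> inv x) ` Y = Y}"
    using Y by (simp add: normalizer_def stabilizer_def eq)
  show ?thesis
    unfolding norm normalizer_in_def using X mem by blast
qed

end

theory Submission
  imports Defs
begin

text \<open>
  Put \<open>D = A \<inter> A\<^sup>b\<close>. Since \<open>b\<close> normalizes \<open>N\<^sub>S(A)\<close>, the groups \<open>A\<close> and \<open>A\<^sup>b\<close> normalize each other, so
  \<open>[A, A\<^sup>b] \<le> D \<le> Z(AA\<^sup>b)\<close> and \<open>AA\<^sup>b\<close> has class at most 2. Hence \<open>a \<mapsto> [a, b]\<close> is a homomorphism modulo \<open>D\<close>,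
  and as \<open>[B, B] \<le> A\<close> its kernel is exactly \<open>D\<close>. So \<open>A\<^sup>*\<close> is the union of the cosets \<open>D[a, b]\<close>, whence
  \<open>|A\<^sup>*| = |A|\<close>; it is abelian because \<open>[[a, b], [a', b]]\<close> is its own inverse. For odd \<open>n\<close> the
  elements \<open>d\<close> and \<open>a\<close> killed by \<open>n\<close> yield \<open>d[a, b]\<close> killed by \<open>n\<close>, and counting cosets modulo
  \<open>\<Omega>\<^sub>i(D)\<close> bounds \<open>\<omega>\<^sub>i(A\<^sup>*)\<close> from below. The rank of an abelian \<open>p\<close>-group is read off from \<open>\<omega>\<^sub>1\<close>.
  The existence of \<open>b\<close> is a fixed point count for \<open>N\<^sub>S(A)\<close> acting on the cosets of \<open>N\<^sub>B(A)\<close> in \<open>B\<close>.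
\<close>

subsection \<open>Conjugation and commutators\<close>

context group
begin

definition conjugate :: "'a \<Rightarrow> 'a \<Rightarrow> 'a" (infixl "\<star>" 75) where
  "x \<star> g = inv g \<otimes> x \<otimes> g"

lemma inv_mult_cancel [simp]:
  assumes "x \<in> carrier G" "y \<in> carrier G"
  shows "x \<otimes> (inv x \<otimes> y) = y" "inv x \<otimes> (x \<otimes> y) = y"
  using assms by (simp_all add: m_assoc [symmetric])

lemma mult_left_commute_commuting:
  assumes "x \<otimes> y = y \<otimes> x" "x \<in> carrier G" "y \<in> carrier G" "z \<in> carrier G"
  shows "y \<otimes> (x \<otimes> z) = x \<otimes> (y \<otimes> z)"
  using assms by (simp add: m_assoc [symmetric])

lemmas word_simps = conjugate_def commutator_def m_assoc inv_mult_group

lemma conjugate_closed [simp]: "x \<in> carrier G \<Longrightarrow> g \<in> carrier G \<Longrightarrow> x \<star> g \<in> carrier G"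
  by (simp add: conjugate_def)

lemma commutator_closed [simp]:
  "x \<in> carrier G \<Longrightarrow> y \<in> carrier G \<Longrightarrow> commutator G x y \<in> carrier G"
  by (simp add: commutator_def)

lemma conjugate_mult:
  "x \<in> carrier G \<Longrightarrow> y \<in> carrier G \<Longrightarrow> g \<in> carrier G \<Longrightarrow> (x \<otimes> y) \<star> g = (x \<star> g) \<otimes> (y \<star> g)"
  by (simp add: word_simps)

lemma conjugate_inv:
  "x \<in> carrier G \<Longrightarrow> g \<in> carrier G \<Longrightarrow> inv x \<star> g = inv (x \<star> g)"
  by (simp add: word_simps)

lemma conjugate_conjugate:
  "x \<in> carrier G \<Longrightarrow> g \<in> carrier G \<Longrightarrow> h \<in> carrier G \<Longrightarrow> x \<star> g \<star> h = x \<star> (g \<otimes> h)"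
  by (simp add: word_simps)

lemma conjugate_one [simp]: "x \<in> carrier G \<Longrightarrow> x \<star> \<one> = x"
  by (simp add: word_simps)

lemma one_conjugate [simp]: "g \<in> carrier G \<Longrightarrow> \<one> \<star> g = \<one>"
  by (simp add: word_simps)

lemma conjugate_cancel [simp]:
  "x \<in> carrier G \<Longrightarrow> g \<in> carrier G \<Longrightarrow> x \<star> g \<star> inv g = x"
  "x \<in> carrier G \<Longrightarrow> g \<in> carrier G \<Longrightarrow> x \<star> inv g \<star> g = x"
  by (simp_all add: conjugate_conjugate)

lemma conjugate_commuting:
  "x \<in> carrier G \<Longrightarrow> g \<in> carrier G \<Longrightarrow> x \<otimes> g = g \<otimes> x \<Longrightarrow> x \<star> g = x"
  by (simp add: word_simps)

lemma conjugate_pow: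
  assumes "x \<in> carrier G" "g \<in> carrier G"
  shows "(x \<star> g) [^] (n::nat) = (x [^] n) \<star> g"
  using assms by (induction n) (simp_all add: conjugate_mult)

lemma conj_set_eq: "conj_set G A g = (\<lambda>a. a \<star> g) ` A"
  by (simp add: conj_set_def conjugate_def)

lemma mem_conj_set_iff:
  assumes "A \<subseteq> carrier G" "g \<in> carrier G" "x \<in> carrier G"
  shows "x \<in> conj_set G A g \<longleftrightarrow> x \<star> inv g \<in> A"
  using assms unfolding conj_set_eq by (auto simp: image_iff intro!: bexI [of _ "x \<star> inv g"])

lemma inj_on_conjugate: "g \<in> carrier G \<Longrightarrow> inj_on (\<lambda>x. x \<star> g) (carrier G)"
  by (rule inj_on_inverseI [of _ "\<lambda>x. x \<star> inv g"]) simp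

text \<open>Conjugation is injective, so a finite set that it maps into itself is mapped onto
  itself. This reduces every normalizer condition to one inclusion.\<close>

lemma conj_set_eq_iff:
  assumes "finite A" "A \<subseteq> carrier G" "g \<in> carrier G"
  shows "conj_set G A g = A \<longleftrightarrow> (\<forall>a\<in>A. a \<star> g \<in> A)"
proof
  assume "\<forall>a\<in>A. a \<star> g \<in> A"
  then show "conj_set G A g = A"
    unfolding conj_set_eq
    using assms inj_on_conjugate [of g] by (intro endo_inj_surj) (auto intro: inj_on_subset)
qed (auto simp: conj_set_eq)

lemma commutator_eq:
  "x \<in> carrier G \<Longrightarrow> y \<in> carrier G \<Longrightarrow> commutator G x y = inv x \<otimes> (x \<star> y)"
  by (simp add: word_simps)

lemma conjugate_eq_mult_commutator:
  "x \<in> carrier G \<Longrightarrow> y \<in> carrier G \<Longrightarrow> x \<star> y = x \<otimes> commutator G x y"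
  by (simp add: word_simps)

lemma commutator_mem_derived:
  assumes "subgroup B G" "x \<in> B" "y \<in> B"
  shows "commutator G x y \<in> derived G B"
proof -
  have B: "B \<subseteq> carrier G" and "inv x \<in> B" "inv y \<in> B"
    using assms by (auto simp: subgroup.subset subgroup.m_inv_closed)
  moreover have "commutator G x y = inv x \<otimes> inv y \<otimes> inv (inv x) \<otimes> inv (inv y)"
    using assms B by (simp add: commutator_def subsetD)
  ultimately show ?thesis
    unfolding derived_def by (blast intro: generate.incl)
qed

lemma normal_conjugate_mem:
  assumes "B \<lhd> G" "x \<in> B" "g \<in> carrier G"
  shows "x \<star> g \<in> B"
  using normal.inv_op_closed1 [OF assms(1,3,2)] by (simp add: conjugate_def)

text \<open>
  Up to inversion of arguments, \<open>s\<close>, \<open>t\<close>, \<open>v\<close> are the commutators \<open>[a, y]\<close>, \<open>[c, x]\<close>, \<open>[x, y]\<close>: the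
  lemma is bilinearity of the commutator in class 2, applied to \<open>[ax, cy] = 1\<close>.
\<close>
lemma central_commutator_relation:
  assumes car: "{a, c, x, y, s, t, v} \<subseteq> carrier G"
    and ac: "a \<otimes> c = c \<otimes> a"
    and s: "a \<otimes> y = s \<otimes> (y \<otimes> a)"
    and t: "c \<otimes> x = t \<otimes> (x \<otimes> c)"
    and v: "x \<otimes> y = v \<otimes> (y \<otimes> x)"
    and s_central: "\<And>z. z \<in> {a, c, x, y, t, v} \<Longrightarrow> s \<otimes> z = z \<otimes> s"
    and t_central: "\<And>z. z \<in> {a, c, x, y, s, v} \<Longrightarrow> t \<otimes> z = z \<otimes> t"
    and v_central: "\<And>z. z \<in> {a, c, x, y, s, t} \<Longrightarrow> v \<otimes> z = z \<otimes> v"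
    and eq: "(a \<otimes> x) \<otimes> (c \<otimes> y) = (c \<otimes> y) \<otimes> (a \<otimes> x)"
  shows "v \<otimes> s = t"
proof -
  have [simp]: "a \<in> carrier G" "c \<in> carrier G" "x \<in> carrier G" "y \<in> carrier G"
    "s \<in> carrier G" "t \<in> carrier G" "v \<in> carrier G"
    using car by auto
  note mv = mult_left_commute_commuting
  have "t \<otimes> ((a \<otimes> x) \<otimes> (c \<otimes> y)) = a \<otimes> (t \<otimes> (x \<otimes> c)) \<otimes> y"
    using t_central mv [of t a] by (simp add: m_assoc)
  also have "\<dots> = (a \<otimes> c) \<otimes> (x \<otimes> y)"
    by (simp add: t [symmetric] m_assoc)
  also have "\<dots> = v \<otimes> (c \<otimes> (a \<otimes> y) \<otimes> x)"
    using v_central mv [of v c] mv [of v a] by (simp add: ac v m_assoc)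
  also have "\<dots> = v \<otimes> s \<otimes> ((c \<otimes> y) \<otimes> (a \<otimes> x))"
    using s_central mv [of s c] by (simp add: s m_assoc)
  finally show ?thesis
    unfolding eq by (simp)
qed

text \<open>The collection formula in class 2: sorting the word produces one factor \<open>c\<close>
  for each of the n(n-1)/2 passages of a \<open>w\<close> over a \<open>u\<close>.\<close>

lemma pow_mult_class2:
  assumes car: "u \<in> carrier G" "w \<in> carrier G" "c \<in> carrier G"
    and c: "w \<otimes> u = c \<otimes> (u \<otimes> w)" and cu: "c \<otimes> u = u \<otimes> c" and cw: "c \<otimes> w = w \<otimes> c"
  shows "(u \<otimes> w) [^] (n::nat) = c [^] (n * (n - 1) div 2) \<otimes> (u [^] n \<otimes> w [^] n)"
proof (induction n)
  case (Suc n)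
  \<comment> \<open>Moving one \<open>u\<close> past \<open>n\<close> copies of \<open>w\<close>
    costs \<open>c [^] n\<close>; these costs add up to the binomial exponent.\<close>
  have wn: "w [^] n \<otimes> u = c [^] n \<otimes> (u \<otimes> w [^] n)" for n :: nat
  proof (induction n)
    case (Suc n)
    have "w [^] Suc n \<otimes> u = w [^] n \<otimes> (w \<otimes> u)"
      using car by (simp add: m_assoc)
    also have "\<dots> = c \<otimes> (w [^] n \<otimes> u) \<otimes> w"
      using car cw group_commutes_pow [of w c n]
        mult_left_commute_commuting [of c "w [^] n" "u \<otimes> w"]
      by (simp add: c m_assoc)
    also have "\<dots> = (c [^] n \<otimes> c) \<otimes> (u \<otimes> (w [^] n \<otimes> w))"
      using car group_commutes_pow [of c c n] by (simp add: Suc m_assoc [symmetric])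
    finally show ?case by simp
  qed (use car in simp)
  have cc: "c [^] n \<otimes> z = z \<otimes> c [^] n" if "c \<otimes> z = z \<otimes> c" "z \<in> carrier G" for n :: nat and z
    using that car group_commutes_pow by blast
  have "(u \<otimes> w) [^] Suc n = c [^] (n * (n - 1) div 2) \<otimes> (u [^] n \<otimes> (w [^] n \<otimes> u) \<otimes> w)"
    using car Suc by (simp add: m_assoc)
  also have "\<dots> = c [^] (n * (n - 1) div 2) \<otimes> ((u [^] n \<otimes> c [^] n) \<otimes> (u \<otimes> w [^] n) \<otimes> w)"
    using car by (simp add: wn m_assoc)
  also have "u [^] n \<otimes> c [^] n = c [^] n \<otimes> u [^] n"
    using car cu cc [of "u [^] n" n] group_commutes_pow [of u c n] by simp
  also have "c [^] (n * (n - 1) div 2) \<otimes> (c [^] n \<otimes> u [^] n \<otimes> (u \<otimes> w [^] n) \<otimes> w)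
      = c [^] (n * (n - 1) div 2 + n) \<otimes> (u [^] Suc n \<otimes> w [^] Suc n)"
    using car by (simp add: m_assoc nat_pow_mult [symmetric])
  also have "n * (n - 1) div 2 + n = Suc n * (Suc n - 1) div 2"
    by (cases n) (auto simp: algebra_simps)
  finally show ?case .
qed (use car in simp)

subsection \<open>Counting\<close>

text \<open>By \<open>inj\<close>, elements of \<open>X\<close> from distinct right cosets of
  \<open>D\<close> have images in distinct cosets. Pairing with \<open>D\<close> turns this into an
  injection from \<open>X \<times> D\<close> to \<open>Y \<times> D\<close>, and the factor |D|
  cancels.\<close>

lemma card_le_modulo_subgroup:
  assumes D: "subgroup D G" "finite D" and Y: "finite Y"
    and X: "X \<subseteq> carrier G" and f: "f ` X \<subseteq> carrier G"
    and DY: "\<And>d x. d \<in> D \<Longrightarrow> x \<in> X \<Longrightarrow> d \<otimes> f x \<in> Y"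
    and inj: "\<And>x x'. x \<in> X \<Longrightarrow> x' \<in> X \<Longrightarrow> f x \<otimes> inv (f x') \<in> D \<Longrightarrow> x \<otimes> inv x' \<in> D"
  shows "card X \<le> card Y"
proof -
  have Dc: "D \<subseteq> carrier G" by (simp add: D subgroup.subset)
  \<comment> \<open>For a product \<open>d \<otimes> f x\<close>, \<open>r\<close> chooses a
    preimage in the coset of \<open>x\<close>; the second entry of \<open>g\<close> records the
    displacement of \<open>x\<close> from that choice.\<close>
  define r where "r y = (SOME x. x \<in> X \<and> (\<exists>d\<in>D. y = d \<otimes> f x))" for y
  define g where "g = (\<lambda>(x, d). (d \<otimes> f x, x \<otimes> inv (r (d \<otimes> f x))))"
  have r: "r (d \<otimes> f x) \<in> X" "x \<otimes> inv (r (d \<otimes> f x)) \<in> D" if "x \<in> X" "d \<in> D" for x d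
  proof -
    have "\<exists>x'. x' \<in> X \<and> (\<exists>e\<in>D. d \<otimes> f x = e \<otimes> f x')"
      using that by blast
    then have "r (d \<otimes> f x) \<in> X \<and> (\<exists>e\<in>D. d \<otimes> f x = e \<otimes> f (r (d \<otimes> f x)))"
      unfolding r_def by (rule someI_ex)
    then obtain e where e: "r (d \<otimes> f x) \<in> X" "e \<in> D" "d \<otimes> f x = e \<otimes> f (r (d \<otimes> f x))"
      by blast
    have car: "f x \<in> carrier G" "f (r (d \<otimes> f x)) \<in> carrier G" "d \<in> carrier G" "e \<in> carrier G"
      using that e f Dc by auto
    have "f x = inv d \<otimes> (d \<otimes> f x)"
      using car by simp
    then have "f x = inv d \<otimes> (e \<otimes> f (r (d \<otimes> f x)))"
      using e(3) by simp
    then have "f x \<otimes> inv (f (r (d \<otimes> f x))) = inv d \<otimes> e \<otimes> (f (r (d \<otimes> f x)) \<otimes> inv (f (r (d \<otimes> f x))))"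
      using car by (metis inv_closed m_assoc m_closed)
    also have "\<dots> \<in> D"
      using car that e D by (simp add: subgroup.m_closed subgroup.m_inv_closed)
    finally show "x \<otimes> inv (r (d \<otimes> f x)) \<in> D"
      using inj that e(1) by blast
    show "r (d \<otimes> f x) \<in> X" by (fact e(1))
  qed
  have "inj_on g (X \<times> D)"
  proof (rule inj_onI, clarify)
    fix x d x' d' assume *: "x \<in> X" "d \<in> D" "x' \<in> X" "d' \<in> D" "g (x, d) = g (x', d')"
    then have 1: "d \<otimes> f x = d' \<otimes> f x'"
      and 2: "x \<otimes> inv (r (d \<otimes> f x)) = x' \<otimes> inv (r (d \<otimes> f x))"
      by (auto simp: g_def)
    have "x = x'"
      using 2 r(1) [OF *(1,2)] *(1,3) X by (metis inv_closed right_cancel subsetD)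
    then show "x = x' \<and> d = d'"
      using 1 * f Dc by (metis imageI right_cancel subsetD)
  qed
  moreover have "g ` (X \<times> D) \<subseteq> Y \<times> D"
    using r DY by (auto simp: g_def)
  ultimately have "card (X \<times> D) \<le> card (Y \<times> D)"
    using D Y by (intro card_inj_on_le [of g]) simp_all
  moreover have "card D > 0"
    using D by (metis card_gt_0_iff empty_iff subgroup.one_closed)
  ultimately show ?thesis
    by (simp add: card_cartesian_product)
qed

end

section \<open>Fixed points of p-groups and the existence of b\<close>

lemma (in group_action) fixed_point_of_p_group:
  assumes p: "Factorial_Ring.prime p" and G: "finite (carrier G)" "order G = p ^ k"
    and F: "F \<subseteq> E" "finite F" "\<And>g x. g \<in> carrier G \<Longrightarrow> x \<in> F \<Longrightarrow> \<phi> g x \<in> F"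
    and dvd: "p dvd card F"
    and x0: "x0 \<in> F" "\<And>g. g \<in> carrier G \<Longrightarrow> \<phi> g x0 = x0"
  obtains x where "x \<in> F" "x \<noteq> x0" "\<And>g. g \<in> carrier G \<Longrightarrow> \<phi> g x = x"
proof (rule ccontr)
  assume "\<not> thesis"
  then have nofix: "\<exists>g\<in>carrier G. \<phi> g x \<noteq> x" if "x \<in> F" "x \<noteq> x0" for x
    using that \<open>\<And>x. \<lbrakk>x \<in> F; x \<noteq> x0; \<And>g. g \<in> carrier G \<Longrightarrow> \<phi> g x = x\<rbrakk> \<Longrightarrow> thesis\<close> by blast
  \<comment> \<open>Were \<open>x0\<close> the only fixed point in \<open>F\<close>, all other
    orbits in \<open>F\<close> would have sizes that divide \<open>p ^ k\<close> and differ from 1,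
    so p would divide |F| - 1 as well as |F|.\<close>
  define C where "C = orbit G \<phi> ` (F - {x0})"
  have orb_eq: "orbit G \<phi> y = orbit G \<phi> x" if "x \<in> E" "y \<in> orbit G \<phi> x" for x y
  proof -
    have sub: "orbit G \<phi> z \<subseteq> E" if "z \<in> E" for z
      using that element_image by (auto simp: orbit_def)
    then have "y \<in> E" using that by blast
    then show ?thesis
      using that sub orbit_sym [of x y] orbit_trans [of x y] orbit_trans [of y x] by blast
  qed
  have orb_F: "orbit G \<phi> x \<subseteq> F - {x0}" if "x \<in> F - {x0}" for x
  proof
    fix y assume y: "y \<in> orbit G \<phi> x"
    then have "y \<in> F" using that F(3) by (auto simp: orbit_def)
    moreover have "y \<noteq> x0"
    proof
      assume "y = x0"
      then have "x \<in> orbit G \<phi> x0"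
        using y that x0 F(1) orbit_sym by blast
      then show False using that x0 by (auto simp: orbit_def)
    qed
    ultimately show "y \<in> F - {x0}" by simp
  qed
  have "\<Union>C = F - {x0}"
    using orb_F orbit_refl F(1) by (force simp: C_def)
  moreover have "p dvd card (\<Union>C)"
  proof (rule dvd_partition)
    show "finite (\<Union>C)" using \<open>\<Union>C = F - {x0}\<close> F by simp
    show "\<forall>c\<in>C. p dvd card c"
    proof
      fix c assume "c \<in> C"
      then obtain x where x: "x \<in> F" "x \<noteq> x0" and c: "c = orbit G \<phi> x"
        by (auto simp: C_def)
      have fin: "finite c"
        using orb_F [of x] x F(2) c by (auto intro: finite_subset)
      have xc: "x \<in> c" using orbit_refl x F(1) c by blast
      have "card c dvd p ^ k"
        using orbit_stabilizer_theorem [of x] x F(1) G c by (metis dvd_triv_left subsetD)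
      moreover have "card c \<noteq> 1"
      proof
        assume "card c = 1"
        then obtain z where "c = {z}" by (meson card_1_singletonE)
        then have "c = {x}" using xc by auto
        then show False using nofix [OF x] c by (auto simp: orbit_def)
      qed
      ultimately show "p dvd card c"
        using p by (metis divides_primepow_nat dvd_power gr0I power_0)
    qed
    show "\<forall>c1\<in>C. \<forall>c2\<in>C. c1 \<noteq> c2 \<longrightarrow> c1 \<inter> c2 = {}"
      using orb_eq F(1) unfolding C_def by blast
  qed
  ultimately have "p dvd card F - 1"
    using x0 F by simp
  moreover have "card F > 0" using x0 F by (auto simp: card_gt_0_iff)
  ultimately have "p dvd 1"
    using dvd by (metis One_nat_def Suc_pred dvd_add_right_iff plus_1_eq_Suc add.commute)
  then show False using p by auto
qed

text \<open>\<open>N\<close> acts by conjugation on the right cosets of \<open>B \<inter> N\<close>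
  in \<open>B\<close>. This intersection is itself a fixed coset, and the number of cosets is a
  power of p other than 1, so a second coset is fixed; a representative of it yields
  \<open>b\<close>.\<close>

lemma (in group) exists_normalizing_not_mem:
  assumes fin: "finite (carrier G)" and p: "Factorial_Ring.prime p" and ord: "order G = p ^ k"
    and B: "B \<lhd> G" and N: "subgroup N G" and BN: "\<not> B \<subseteq> N"
  obtains b where "b \<in> B" "b \<notin> N" "\<And>n. n \<in> N \<Longrightarrow> n \<star> b \<in> N"
proof -
  have sB: "subgroup B G" using B by (simp add: normal_imp_subgroup)
  define C where "C = B \<inter> N"
  have C: "subgroup C G" using sB N by (simp add: C_def subgroups_Inter_pair)
  have Cc: "C \<subseteq> carrier G" and Nc: "N \<subseteq> carrier G" and Bc: "B \<subseteq> carrier G"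
    using C N sB by (simp_all add: subgroup.subset)
  \<comment> \<open>The power set action conjugates from the left, so in terms of the right action
    \<open>g\<close> acts as conjugation by \<open>inv g\<close>.\<close>
  define \<phi> where "\<phi> = (\<lambda>g. \<lambda>H \<in> {H. H \<subseteq> carrier G}. g <#\<^bsub>G\<^esub> H #>\<^bsub>G\<^esub> (inv g))"
  interpret act: group_action "G\<lparr>carrier := N\<rparr>" "{H. H \<subseteq> carrier G}" \<phi>
    unfolding \<phi>_def by (rule group_action.induced_action [OF action_by_conjugation_on_power_set N])
  define F where "F = (\<lambda>x. C #> x) ` B"
  have \<phi>: "\<phi> g (C #> x) = C #> (x \<star> inv g)" if g: "g \<in> N" and x: "x \<in> B" for g x
  proof -
    have [simp]: "g \<in> carrier G" "x \<in> carrier G"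
      using that Nc Bc by auto
    have C1: "c \<star> h \<in> C" if "c \<in> C" "h \<in> N" for c h
      using that normal_conjugate_mem [OF B, of c h] N Nc
      by (auto simp: C_def conjugate_def subgroup.m_closed subgroup.m_inv_closed)
    have ing: "inv g \<in> N" using g N by (simp add: subgroup.m_inv_closed)
    have "C #> x \<subseteq> carrier G" using Cc by (simp add: r_coset_subset_G)
    then have "\<phi> g (C #> x) = (\<lambda>c. (c \<star> inv g) \<otimes> (x \<star> inv g)) ` C"
      using Cc by (auto simp: \<phi>_def l_coset_def r_coset_def word_simps subset_iff image_iff)
    also have "\<dots> = C #> (x \<star> inv g)"
    proof -
      have "(\<lambda>c. c \<star> inv g) ` C = C"
        using conj_set_eq_iff [of C "inv g"] C1 ing Cc fin
        by (simp add: conj_set_eq finite_subset)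
      moreover have "C #> y = (\<lambda>c. c \<otimes> y) ` C" for y
        by (auto simp: r_coset_def)
      ultimately show ?thesis
        using image_image [of "\<lambda>c. c \<otimes> (x \<star> inv g)" "\<lambda>c. c \<star> inv g" C] by simp
    qed
    finally show ?thesis .
  qed
  have one_B: "\<one> \<in> B" using sB by (simp add: subgroup.one_closed)
  have C1: "C #> \<one> = C" using Cc by simp
  obtain x1 where x1: "x1 \<in> B" "x1 \<notin> N" using BN by blast
  have mem_C: "x \<in> C" if "x \<in> B" "C #> x = C" for x
    using that C Bc by (metis rcos_self subsetD)
  have dvd: "p dvd card F"
  proof -
    interpret GB: group "G\<lparr>carrier := B\<rparr>" by (rule subgroup_imp_group [OF sB])
    have "subgroup C (G\<lparr>carrier := B\<rparr>)"
      using C sB by (simp add: C_def subgroup_incl)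
    then have "card (rcosets\<^bsub>G\<lparr>carrier := B\<rparr>\<^esub> C) * card C = order (G\<lparr>carrier := B\<rparr>)"
      by (rule GB.lagrange)
    moreover have "rcosets\<^bsub>G\<lparr>carrier := B\<rparr>\<^esub> C = F"
      by (auto simp: RCOSETS_def F_def r_coset_def)
    ultimately have "card F dvd card B"
      by (simp add: order_def) (metis dvd_triv_left)
    also have "card B dvd p ^ k"
      using lagrange [OF sB] ord by (metis dvd_triv_right)
    finally have "card F dvd p ^ k" .
    moreover have "card F \<noteq> 1"
    proof
      assume "card F = 1"
      then obtain z where "F = {z}" by (meson card_1_singletonE)
      then have "C #> x1 = C"
        using x1 one_B C1 unfolding F_def by (metis imageI singletonD)
      then show False using mem_C x1 by (auto simp: C_def)
    qed
    ultimately show ?thesis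
      using p by (auto simp: divides_primepow_nat)
  qed
  have "order (G\<lparr>carrier := N\<rparr>) dvd p ^ k"
    using lagrange [OF N] ord dvd_triv_right [of "card N" "card (rcosets N)"] by (simp add: order_def)
  then obtain j where j: "order (G\<lparr>carrier := N\<rparr>) = p ^ j"
    using p by (metis divides_primepow_nat)
  have finN: "finite (carrier (G\<lparr>carrier := N\<rparr>))"
    using fin Nc by (simp add: finite_subset)
  have F: "F \<subseteq> {H. H \<subseteq> carrier G}" "finite F"
    using Cc Bc fin by (auto simp: F_def finite_subset subset_iff r_coset_def)
  have inv: "\<phi> g X \<in> F" if "g \<in> carrier (G\<lparr>carrier := N\<rparr>)" "X \<in> F" for g X
    using that \<phi> B Nc N normal_conjugate_mem [OF B]
    by (auto simp: F_def subset_iff subgroup.m_inv_closed)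
  have CF: "C \<in> F" using one_B C1 unfolding F_def by (metis imageI)
  have fixC: "\<phi> g C = C" if "g \<in> carrier (G\<lparr>carrier := N\<rparr>)" for g
    using \<phi> [of g \<one>] that one_B C1 Nc by (auto simp: subset_iff)
  obtain X where X: "X \<in> F" "X \<noteq> C" "\<And>g. g \<in> carrier (G\<lparr>carrier := N\<rparr>) \<Longrightarrow> \<phi> g X = X"
  proof (rule act.fixed_point_of_p_group [OF p finN j F inv dvd CF fixC])
    fix x
    assume "x \<in> F" "x \<noteq> C" "\<And>g. g \<in> carrier (G\<lparr>carrier := N\<rparr>) \<Longrightarrow> \<phi> g x = x"
    then show ?thesis by (rule that)
  qed
  then obtain x where x: "x \<in> B" "X = C #> x" by (auto simp: F_def)
  have xc [simp]: "x \<in> carrier G" using x Bc by blast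
  have "x \<notin> C"
    using X(2) x(2) coset_join2 [OF xc C] by metis
  show thesis
  proof
    \<comment> \<open>The fixed coset gives \<open>x \<star> n = c \<otimes> x\<close> with
      \<open>c\<close> in \<open>C\<close>. Solved for a conjugate of \<open>n\<close>, this reads
      \<open>n \<star> inv x = n \<otimes> c\<close>, hence the inverse.\<close>
    show "inv x \<in> B" using x sB by (simp add: subgroup.m_inv_closed)
    show "inv x \<notin> N"
      using \<open>x \<notin> C\<close> x N C_def by (metis IntI inv_inv subgroup.m_inv_closed xc)
    fix n assume n: "n \<in> N"
    have [simp]: "n \<in> carrier G" using n Nc by blast
    have "C #> (x \<star> n) = C #> x"
      using \<phi> [of "inv n" x] X(3) [of "inv n"] x n N by (simp add: subgroup.m_inv_closed)
    then have "x \<star> n \<in> C #> x"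
      using rcos_self [OF _ C, of "x \<star> n"] by simp
    then obtain c where c: "c \<in> C" "x \<star> n = c \<otimes> x"
      by (auto simp: r_coset_def)
    have [simp]: "c \<in> carrier G" using c Cc by blast
    have "n \<star> inv x = n \<otimes> (x \<star> n \<otimes> inv x)"
      by (simp add: word_simps)
    also have "\<dots> = n \<otimes> c" by (simp add: c m_assoc)
    also have "\<dots> \<in> N" using n c N by (simp add: C_def subgroup.m_closed)
    finally show "n \<star> inv x \<in> N" .
  qed
qed

subsection \<open>The rank of an abelian \<open>p\<close>-group\<close>

lemma (in group) generate_subgroup_eq: "subgroup H G \<Longrightarrow> generate G H = H"
  using generate_subgroup_incl [of H H] generate.incl [of _ H G] by blast

lemma (in group) subgroup_of_p_group_order:
  assumes "Factorial_Ring.prime p" "order G = p ^ k" "subgroup H G"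
  obtains j where "card H = p ^ j"
  using lagrange [OF assms(3)] assms(1,2) by (metis divides_primepow_nat dvd_triv_right)

locale abelian_p_group = comm_group G for G (structure) +
  fixes p k :: nat
  assumes prime_p: "Factorial_Ring.prime p"
    and order_eq: "order G = p ^ k"
begin

text \<open>This is the Frattini subgroup of an abelian p-group;
  \<open>generate_of_generate_Un_P\<close> is its nongenerator property.\<close>

definition P :: "'a set" where
  "P = (\<lambda>x. x [^] p) ` carrier G"

lemma finite_carrier: "finite (carrier G)"
  using order_eq prime_p order_gt_0_iff_finite by (simp add: prime_gt_0_nat)

lemma subgroup_P: "subgroup P G"
proof (rule subgroupI)
  show "P \<noteq> {}" by (auto simp: P_def)
  show "inv a \<in> P" if "a \<in> P" for a
    using that unfolding P_def by (auto simp: nat_pow_inv [symmetric])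
  show "a \<otimes> b \<in> P" if "a \<in> P" "b \<in> P" for a b
    using that unfolding P_def by (auto simp: nat_pow_distrib [symmetric])
qed (auto simp: P_def)

text \<open>The first isomorphism theorem for the p-th power map, an endomorphism because the group
  is commutative.\<close>

lemma card_P: "card P * card {x \<in> carrier G. x [^] p = \<one>} = order G"
proof -
  interpret h: group_hom G "G\<lparr>carrier := P\<rparr>" "\<lambda>x. x [^] p"
    unfolding group_hom_def group_hom_axioms_def
    using subgroup_imp_group [OF subgroup_P] is_group
    by (auto simp: P_def hom_def nat_pow_distrib)
  let ?K = "kernel G (G\<lparr>carrier := P\<rparr>) (\<lambda>x. x [^] p)"
  have "bij_betw (\<lambda>X. the_elem ((\<lambda>x. x [^] p) ` X)) (carrier (G Mod ?K)) P"
    using h.FactGroup_iso_set by (simp add: P_def iso_def)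
  then have "card (rcosets ?K) = card P"
    by (simp add: FactGroup_def bij_betw_same_card)
  moreover have "?K = {x \<in> carrier G. x [^] p = \<one>}"
    by (simp add: kernel_def)
  ultimately show ?thesis
    using lagrange [OF h.subgroup_kernel] by simp
qed

text \<open>The p-th power of a new generator already lies in \<open>P\<close>, so only its
  exponents below p matter and the order grows by a factor of at most p.\<close>

lemma card_generate_Un_P:
  assumes "finite X" "X \<subseteq> carrier G"
  shows "card (generate G (X \<union> P)) \<le> p ^ card X * card P"
  using assms
proof (induction X rule: finite_induct)
  case empty
  then show ?case by (simp add: generate_subgroup_eq subgroup_P)
next
  case (insert x X)
  define H where "H = generate G (X \<union> P)"
  have Pc: "P \<subseteq> carrier G" using subgroup_P by (simp add: subgroup.subset)
  have x: "x \<in> carrier G" using insert by simp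
  have H: "subgroup H G"
    unfolding H_def using insert Pc by (intro generate_is_subgroup) simp
  have xp: "x [^] p \<in> H"
    unfolding H_def using x by (auto simp: P_def intro: generate.incl)
  have "subgroup (H <#> generate G {x}) G"
    using H x by (intro mult_subgroups generate_is_subgroup) simp_all
  moreover have "insert x X \<union> P \<subseteq> H <#> generate G {x}"
  proof -
    have "x = \<one> \<otimes> x" using x by simp
    then have "x \<in> H <#> generate G {x}"
      using H unfolding set_mult_def by (blast intro: generate.incl subgroup.one_closed)
    moreover have "y \<in> H <#> generate G {x}" if "y \<in> X \<union> P" for y
    proof -
      have "y \<in> H" unfolding H_def using that by (rule generate.incl)
      moreover have "y = y \<otimes> \<one>" using that insert Pc by auto
      ultimately show ?thesis
        unfolding set_mult_def by (blast intro: generate.one)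
    qed
    ultimately show ?thesis by blast
  qed
  ultimately have "generate G (insert x X \<union> P) \<subseteq> H <#> generate G {x}"
    by (rule generate_subgroup_incl [rotated])
  also have "\<dots> \<subseteq> (\<lambda>(h, i). h \<otimes> x [^] (i::nat)) ` (H \<times> {..<p})"
  proof
    fix y assume "y \<in> H <#> generate G {x}"
    then obtain h and i :: int where h: "h \<in> H" "y = h \<otimes> x [^] i"
      using x by (auto simp: set_mult_def generate_pow)
    have hc: "h \<in> carrier G" using subgroup.mem_carrier [OF H h(1)] .
    \<comment> \<open>The exponent \<open>i\<close> is split into its remainder \<open>j\<close> and
      a multiple of p; the power belonging to the multiple is absorbed into
      \<open>H\<close>.\<close>
    define j where "j = nat (i mod int p)"
    have p0: "0 < p" using prime_p by (simp add: prime_gt_0_nat)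
    have ij: "i = int p * (i div int p) + int j"
      using p0 by (simp add: j_def)
    have "x [^] i = x [^] (int p * (i div int p)) \<otimes> x [^] int j"
      using x ij int_pow_mult by metis
    also have "\<dots> = (x [^] p) [^] (i div int p) \<otimes> x [^] j"
      using x by (simp add: int_pow_pow [symmetric] int_pow_int)
    finally have "y = (h \<otimes> (x [^] p) [^] (i div int p)) \<otimes> x [^] j"
      using x hc h by (simp add: m_assoc)
    moreover have "h \<otimes> (x [^] p) [^] (i div int p) \<in> H"
      using h xp H by (simp add: subgroup.m_closed subgroup_int_pow_closed)
    moreover have "j < p" using p0 by (simp add: j_def nat_less_iff)
    ultimately show "y \<in> (\<lambda>(h, i). h \<otimes> x [^] (i::nat)) ` (H \<times> {..<p})"
      by (auto intro!: image_eqI [of _ _ "(h \<otimes> (x [^] p) [^] (i div int p), j)"])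
  qed
  finally have "generate G (insert x X \<union> P) \<subseteq> (\<lambda>(h, i). h \<otimes> x [^] (i::nat)) ` (H \<times> {..<p})" .
  moreover have "finite (H \<times> {..<p})"
    using finite_subset [OF subgroup.subset [OF H] finite_carrier] by simp
  ultimately have "card (generate G (insert x X \<union> P)) \<le> card (H \<times> {..<p})"
    by (meson card_image_le card_mono finite_imageI le_trans)
  also have "\<dots> \<le> p ^ card X * card P * p"
    using insert by (simp add: card_cartesian_product H_def)
  finally show ?case
    using insert by (simp add: ac_simps)
qed

text \<open>Every element has the form \<open>h \<otimes> z [^] p\<close> with \<open>h\<close> in
  the subgroup generated by \<open>X\<close>. Substituting for \<open>z\<close> again and again
  raises the exponent to \<open>p ^ k\<close>, which kills the group.\<close>

lemma generate_of_generate_Un_P: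
  assumes X: "X \<subseteq> carrier G" and gen: "generate G (X \<union> P) = carrier G"
  shows "generate G X = carrier G"
proof -
  define H where "H = generate G X"
  have H: "subgroup H G" unfolding H_def using X by (rule generate_is_subgroup)
  have Hc: "H \<subseteq> carrier G" using H by (rule subgroup.subset)
  have HP: "\<exists>h\<in>H. \<exists>z\<in>carrier G. g = h \<otimes> z [^] p" if "g \<in> carrier G" for g
  proof -
    have "X \<union> P \<subseteq> H <#> P"
    proof
      fix y assume y: "y \<in> X \<union> P"
      then have yc: "y \<in> carrier G" using X subgroup_P by (auto intro: subgroup.mem_carrier)
      have "y = y \<otimes> \<one>" "y = \<one> \<otimes> y" using yc by simp_all
      then show "y \<in> H <#> P"
        using y H subgroup_P unfolding set_mult_def H_def
        by (blast intro: generate.incl generate.one subgroup.one_closed)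
    qed
    then have "generate G (X \<union> P) \<subseteq> H <#> P"
      by (rule generate_subgroup_incl [OF _ mult_subgroups [OF H subgroup_P]])
    then have "g \<in> H <#> P" using gen that by blast
    then show ?thesis by (auto simp: set_mult_def P_def)
  qed
  have "\<exists>h\<in>H. \<exists>z\<in>carrier G. g = h \<otimes> z [^] (p ^ n)" if "g \<in> carrier G" for g n
    using that
  proof (induction n arbitrary: g)
    case 0
    then show ?case
      using H by (intro bexI [of _ \<one>] bexI [of _ g]) (simp_all add: subgroup.one_closed)
  next
    case (Suc n)
    obtain h z where hz: "h \<in> H" "z \<in> carrier G" "g = h \<otimes> z [^] p"
      using HP Suc.prems by blast
    obtain h' z' where hz': "h' \<in> H" "z' \<in> carrier G" "z = h' \<otimes> z' [^] (p ^ n)"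
      using Suc.IH [OF hz(2)] by blast
    have c: "h \<in> carrier G" "h' \<in> carrier G" using hz hz' Hc by auto
    have "g = (h \<otimes> h' [^] p) \<otimes> z' [^] (p ^ Suc n)"
      using hz hz' c by (simp add: nat_pow_distrib m_assoc nat_pow_pow mult.commute)
    moreover have "h' [^] p \<in> H"
      using subgroup_int_pow_closed [OF H hz'(1), of "int p"] by (simp add: int_pow_int)
    then have "h \<otimes> h' [^] p \<in> H"
      using hz H by (simp add: subgroup.m_closed)
    ultimately show ?case using hz' by blast
  qed
  from this [of _ k] have "g \<in> H" if "g \<in> carrier G" for g
    using that pow_order_eq_1 order_eq Hc by (metis r_one subsetD)
  then show ?thesis using Hc by (auto simp: H_def)
qed

text \<open>Greedy choice: adjoining an element outside \<open>H\<close> multiplies the order by at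
  least p, since both orders are powers of p. The bound is opposite to that of
  \<open>card_generate_Un_P\<close>.\<close>

lemma exists_generating_set_modulo_subgroup:
  assumes "subgroup H G"
  shows "\<exists>X. X \<subseteq> carrier G \<and> finite X \<and> generate G (X \<union> H) = carrier G \<and>
    p ^ card X * card H \<le> order G"
  using assms
proof (induction "order G - card H" arbitrary: H rule: less_induct)
  case less
  have Hc: "H \<subseteq> carrier G" using less.prems by (rule subgroup.subset)
  show ?case
  proof (cases "H = carrier G")
    case True
    then show ?thesis
      using less.prems by (intro exI [of _ "{}"]) (simp add: generate_subgroup_eq order_def)
  next
    case False
    then obtain x where x: "x \<in> carrier G" "x \<notin> H" using Hc by blast
    define H' where "H' = generate G (insert x H)"
    have H': "subgroup H' G" unfolding H'_def using x Hc by (intro generate_is_subgroup) simp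
    have sub: "insert x H \<subseteq> H'" unfolding H'_def by (auto intro: generate.incl)
    have fin: "finite H'" using H' finite_carrier by (meson finite_subset subgroup.subset)
    have lt: "card H < card H'" using sub x fin by (intro psubset_card_mono) auto
    have le: "card H' \<le> order G"
      using H' finite_carrier by (simp add: order_def card_mono subgroup.subset)
    obtain i j where ij: "card H = p ^ i" "card H' = p ^ j"
      using subgroup_of_p_group_order [OF prime_p order_eq] less.prems H' by metis
    then have "i < j"
      using lt prime_gt_1_nat [OF prime_p] by simp
    then have pH: "p * card H \<le> card H'"
      using ij prime_gt_1_nat [OF prime_p] power_increasing [of "Suc i" j p] by simp
    obtain X where X: "X \<subseteq> carrier G" "finite X" "generate G (X \<union> H') = carrier G"
      "p ^ card X * card H' \<le> order G"
      using less.hyps [of H'] diff_less_mono2 [of "card H" "card H'" "order G"] lt le H' by auto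
    have Y: "insert x X \<union> H \<subseteq> carrier G" using X x Hc by blast
    have "H' \<subseteq> generate G (insert x X \<union> H)"
      unfolding H'_def by (intro mono_generate) blast
    then have "X \<union> H' \<subseteq> generate G (insert x X \<union> H)"
      by (auto intro: generate.incl)
    then have "carrier G \<subseteq> generate G (insert x X \<union> H)"
      using generate_subgroup_incl [OF _ generate_is_subgroup [OF Y]] X(3) by blast
    then have "generate G (insert x X \<union> H) = carrier G"
      using generate_incl [OF Y] by blast
    moreover have "p ^ card (insert x X) * card H \<le> order G"
    proof -
      have "p ^ card (insert x X) * card H \<le> p ^ Suc (card X) * card H"
        using prime_gt_1_nat [OF prime_p] X(2)
        by (intro mult_right_mono power_increasing) (auto simp: card_insert_if)
      also have "\<dots> \<le> p ^ card X * card H'"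
        using pH by (simp add: mult.left_commute mult.commute)
      finally show ?thesis using X(4) by simp
    qed
    ultimately show ?thesis
      using X x by (intro exI [of _ "insert x X"]) simp
  qed
qed

text \<open>Both sides equal the index of \<open>P\<close>: greedy generators modulo
  \<open>P\<close> bound the rank from above, and \<open>card_generate_Un_P\<close>, applied to a
  smallest generating set, bounds it from below.\<close>

lemma prime_power_group_rank: "p ^ group_rank G (carrier G) = card {x \<in> carrier G. x [^] p = \<one>}"
proof (rule antisym)
  have P0: "0 < card P"
    using subgroup_P finite_carrier
    by (metis card_gt_0_iff empty_iff finite_subset subgroup.one_closed subgroup.subset)
  obtain X where X: "X \<subseteq> carrier G" "finite X" "generate G (X \<union> P) = carrier G"
    "p ^ card X * card P \<le> order G"
    using exists_generating_set_modulo_subgroup [OF subgroup_P] by blast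
  have genX: "generate G X = carrier G"
    by (rule generate_of_generate_Un_P [OF X(1,3)])
  have "group_rank G (carrier G) \<le> card X"
    unfolding group_rank_def using X genX by (intro Least_le) blast
  then have "p ^ group_rank G (carrier G) \<le> p ^ card X"
    using prime_gt_1_nat [OF prime_p] by (intro power_increasing) auto
  then have "p ^ group_rank G (carrier G) * card P \<le> p ^ card X * card P"
    by simp
  also have "\<dots> \<le> card {x \<in> carrier G. x [^] p = \<one>} * card P"
    using X(4) card_P by (simp add: mult.commute)
  finally show "p ^ group_rank G (carrier G) \<le> card {x \<in> carrier G. x [^] p = \<one>}"
    using P0 by simp
  \<comment> \<open>The minimum in \<open>group_rank\<close> is attained because \<open>X\<close>
    shows that some generating set is finite.\<close>
  have "\<exists>Y\<subseteq>carrier G. finite Y \<and> card Y = group_rank G (carrier G) \<and> generate G Y = carrier G"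
    unfolding group_rank_def
    by (rule LeastI [of "\<lambda>n. \<exists>Y\<subseteq>carrier G. finite Y \<and> card Y = n \<and> generate G Y = carrier G"
          "card X"]) (use X genX in blast)
  then obtain Y where Y: "Y \<subseteq> carrier G" "finite Y" "card Y = group_rank G (carrier G)"
    "generate G Y = carrier G" by blast
  have YP: "Y \<union> P \<subseteq> carrier G" using Y subgroup_P by (simp add: subgroup.subset)
  have "generate G (Y \<union> P) = carrier G"
    using Y(4) mono_generate [of Y "Y \<union> P"] generate_incl [OF YP] by blast
  then have "order G \<le> p ^ card Y * card P"
    using card_generate_Un_P [OF Y(2,1)] by (simp add: order_def)
  then have "card {x \<in> carrier G. x [^] p = \<one>} * card P \<le> p ^ group_rank G (carrier G) * card P"
    using card_P Y(3) by (simp add: mult.commute)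
  then show "card {x \<in> carrier G. x [^] p = \<one>} \<le> p ^ group_rank G (carrier G)"
    using P0 by simp
qed

end

section \<open>Rank and omega of a subgroup as torsion counts\<close>

context group
begin

lemma prime_power_group_rank_subgroup:
  assumes p: "Factorial_Ring.prime p" and ord: "order G = p ^ k"
    and H: "subgroup H G" "comm_group (G\<lparr>carrier := H\<rparr>)"
  shows "p ^ group_rank G H = card {x \<in> H. x [^] p = \<one>}"
proof -
  obtain j where j: "card H = p ^ j"
    using subgroup_of_p_group_order [OF p ord H(1)] .
  interpret H: abelian_p_group "G\<lparr>carrier := H\<rparr>" p j
    using H(2) p j by (intro abelian_p_group.intro abelian_p_group_axioms.intro) (simp_all add: order_def)
  \<comment> \<open>Subsets of \<open>H\<close> generate the same subgroup in \<open>H\<close> as in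
    \<open>G\<close>, so the two minima agree.\<close>
  have "group_rank (G\<lparr>carrier := H\<rparr>) H = group_rank G H"
    unfolding group_rank_def using generate_consistent [OF _ H(1)]
    by (metis (no_types, lifting))
  then show ?thesis
    using H.prime_power_group_rank by (simp add: nat_pow_consistent [symmetric])
qed

text \<open>Element orders are powers of p, so an order is at most \<open>p ^ i\<close> exactly when
  \<open>p ^ i\<close> kills the element. In a commutative group these elements already form a
  subgroup, and \<open>generate\<close> adds nothing.\<close>

lemma omega_eq_card:
  assumes p: "Factorial_Ring.prime p" and ord: "order G = p ^ k"
    and H: "subgroup H G" "comm_group (G\<lparr>carrier := H\<rparr>)"
  shows "omega G p i H = card {x \<in> H. x [^] (p ^ i) = \<one>}"
proof -
  have Hc: "x \<in> carrier G" if "x \<in> H" for x using H(1) that by (rule subgroup.mem_carrier)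
  have comm: "x \<otimes> y = y \<otimes> x" if "x \<in> H" "y \<in> H" for x y
    using comm_groupE(4) [OF H(2)] that by simp
  have "ord a \<le> p ^ i \<longleftrightarrow> a [^] (p ^ i) = \<one>" if "a \<in> H" for a
  proof -
    have "ord a dvd p ^ k" using Hc [OF that] ord ord_dvd_group_order by metis
    then obtain j where j: "ord a = p ^ j" using p by (metis divides_primepow_nat)
    have "a [^] (p ^ i) = \<one> \<longleftrightarrow> p ^ j dvd p ^ i"
      using Hc [OF that] j by (simp add: pow_eq_id)
    also have "\<dots> \<longleftrightarrow> j \<le> i"
      using p by (metis dvd_power_iff_le prime_ge_2_nat)
    also have "\<dots> \<longleftrightarrow> p ^ j \<le> p ^ i"
      using prime_gt_1_nat [OF p] by simp
    finally show ?thesis using j by simp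
  qed
  then have "{a \<in> H. ord a \<le> p ^ i} = {x \<in> H. x [^] (p ^ i) = \<one>}"
    by blast
  moreover have "subgroup {x \<in> H. x [^] (p ^ i) = \<one>} G"
  proof (rule subgroupI)
    show "{x \<in> H. x [^] (p ^ i) = \<one>} \<noteq> {}"
      using subgroup.one_closed [OF H(1)] by auto
  qed (use Hc H(1) in \<open>auto simp: subgroup.m_closed subgroup.m_inv_closed nat_pow_inv
        pow_mult_distrib comm\<close>)
  ultimately show ?thesis
    by (simp add: omega_def Omega_def generate_subgroup_eq)
qed

end

text \<open>The first index at which the sequences differ decides; after the shift by
  \<open>Suc\<close> it falls under the assumption.\<close>

lemma lex_ge_if_omega_ge:
  assumes "\<And>i. i \<ge> 1 \<Longrightarrow> omega G p i A' \<le> omega G p i A"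
  shows "lex_ge G p A A'"
proof (cases "\<forall>i. omega G p (Suc i) A = omega G p (Suc i) A'")
  case False
  define m where "m = (LEAST i. omega G p (Suc i) A \<noteq> omega G p (Suc i) A')"
  have "omega G p (Suc m) A \<noteq> omega G p (Suc m) A'"
    unfolding m_def using False by (metis (mono_tags, lifting) LeastI)
  moreover have "\<forall>i<m. omega G p (Suc i) A' = omega G p (Suc i) A"
    unfolding m_def using not_less_Least by fastforce
  ultimately show ?thesis
    using assms [of "Suc m"] unfolding lex_ge_def less_fun_def by (metis le_neq_implies_less le_add1 plus_1_eq_Suc)
qed (simp add: lex_ge_def)

subsection \<open>The replacement subgroup\<close>

lemma mem_normalizer_in_iff: "x \<in> normalizer_in G X Y \<longleftrightarrow> x \<in> X \<and> conj_set G Y x = Y"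
  by (simp add: normalizer_in_def)

lemma (in group) commuting_mult:
  assumes "d \<otimes> x = x \<otimes> d" "d \<otimes> y = y \<otimes> d" "d \<in> carrier G" "x \<in> carrier G" "y \<in> carrier G"
  shows "d \<otimes> (x \<otimes> y) = (x \<otimes> y) \<otimes> d"
  using assms by (metis m_assoc)

text \<open>In \<open>f_commute\<close> this strips off the factors from \<open>D\<close> that arise
  when conjugating by \<open>inv b\<close>.\<close>

lemma (in group) commuting_cancel_right:
  assumes "x \<in> carrier G" "y \<in> carrier G" "z \<in> carrier G" "w \<in> carrier G"
    and "z \<otimes> y = y \<otimes> z" "w \<otimes> x = x \<otimes> w" "z \<otimes> w = w \<otimes> z"
    and eq: "(x \<otimes> z) \<otimes> (y \<otimes> w) = (y \<otimes> w) \<otimes> (x \<otimes> z)"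
  shows "x \<otimes> y = y \<otimes> x"
proof -
  have "(x \<otimes> y) \<otimes> (z \<otimes> w) = (y \<otimes> x) \<otimes> (z \<otimes> w)"
    using assms mult_left_commute_commuting [of z y w] mult_left_commute_commuting [of w x z]
    by (simp add: m_assoc)
  then show ?thesis
    using assms by simp
qed

text \<open>The case distinction on p is condensed into \<open>odd_or_abelian\<close>, which serves
  to prove \<open>f_commute\<close>. The element \<open>b\<close> is an arbitrary admissible
  one.\<close>

locale replacement = group G for G (structure) +
  fixes A B :: "'a set" and b :: 'a
  assumes finite_carrier: "finite (carrier G)"
    and odd_or_abelian: "odd (order G) \<or> (\<forall>x\<in>B. \<forall>y\<in>B. x \<otimes> y = y \<otimes> x)"
    and normal_B: "B \<lhd> G"
    and subgroup_A: "subgroup A G"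
    and commute_A: "\<And>x y. x \<in> A \<Longrightarrow> y \<in> A \<Longrightarrow> x \<otimes> y = y \<otimes> x"
    and derived_B: "derived G B \<subseteq> A"
    and b_mem: "b \<in> normalizer_in G B (normalizer_in G (carrier G) A) - normalizer_in G B A"
begin

definition N :: "'a set" where
  "N = normalizer_in G (carrier G) A"

definition D :: "'a set" where
  "D = A \<inter> conj_set G A b"

abbreviation f :: "'a \<Rightarrow> 'a" where
  "f a \<equiv> commutator G a b"

lemma A_carrier [simp]: "a \<in> A \<Longrightarrow> a \<in> carrier G"
  using subgroup_A by (rule subgroup.mem_carrier)

lemma A_closed [simp]:
  "x \<in> A \<Longrightarrow> y \<in> A \<Longrightarrow> x \<otimes> y \<in> A" "x \<in> A \<Longrightarrow> inv x \<in> A" "\<one> \<in> A"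
  using subgroup_A by (auto intro: subgroup.m_closed subgroup.m_inv_closed subgroup.one_closed)

lemma subgroup_B: "subgroup B G"
  using normal_B by (simp add: normal_imp_subgroup)

lemma B_carrier [simp]: "x \<in> B \<Longrightarrow> x \<in> carrier G"
  using subgroup_B by (rule subgroup.mem_carrier)

lemma B_closed [simp]:
  "x \<in> B \<Longrightarrow> y \<in> B \<Longrightarrow> x \<otimes> y \<in> B" "x \<in> B \<Longrightarrow> inv x \<in> B" "\<one> \<in> B"
  using subgroup_B by (auto intro: subgroup.m_closed subgroup.m_inv_closed subgroup.one_closed)

lemma b_B [simp]: "b \<in> B"
  using b_mem by (simp add: mem_normalizer_in_iff)

lemma finite_A: "finite A"
  using finite_carrier by (rule finite_subset [rotated]) auto

lemma B_conjugate [simp]: "x \<in> B \<Longrightarrow> g \<in> carrier G \<Longrightarrow> x \<star> g \<in> B"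
  using normal_B by (rule normal_conjugate_mem)

lemma subgroup_N: "subgroup N G"
proof -
  have "A \<subseteq> carrier G" by auto
  then have "N = carrier G \<inter> normalizer G A" "subgroup (normalizer G A) G"
    using normalizer_in_eq_normalizer [of "carrier G" A] normalizer_imp_subgroup
    by (auto simp: N_def)
  then show ?thesis by (simp add: Int_absorb1 subgroup.subset)
qed

lemma N_carrier [simp]: "n \<in> N \<Longrightarrow> n \<in> carrier G"
  using subgroup_N by (rule subgroup.mem_carrier)

lemma N_closed [simp]:
  "x \<in> N \<Longrightarrow> y \<in> N \<Longrightarrow> x \<otimes> y \<in> N" "x \<in> N \<Longrightarrow> inv x \<in> N" "\<one> \<in> N"
  using subgroup_N by (auto intro: subgroup.m_closed subgroup.m_inv_closed subgroup.one_closed)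

lemma mem_N_iff: "n \<in> carrier G \<Longrightarrow> n \<in> N \<longleftrightarrow> (\<forall>a\<in>A. a \<star> n \<in> A)"
  using conj_set_eq_iff [of A n] finite_A by (simp add: N_def mem_normalizer_in_iff subset_iff del: N_carrier)

lemma A_conjugate_N [simp]: "a \<in> A \<Longrightarrow> n \<in> N \<Longrightarrow> a \<star> n \<in> A"
  using mem_N_iff [of n] by auto

lemma N_conjugate_b [simp]: "n \<in> N \<Longrightarrow> n \<star> b \<in> N" "n \<in> N \<Longrightarrow> n \<star> inv b \<in> N"
proof -
  have eq: "conj_set G N b = N"
    using b_mem unfolding N_def by (simp add: mem_normalizer_in_iff)
  show "n \<in> N \<Longrightarrow> n \<star> b \<in> N"
    using eq by (auto simp: conj_set_eq)
  show "n \<in> N \<Longrightarrow> n \<star> inv b \<in> N"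
    using eq mem_conj_set_iff [of N b n] by (auto simp: subset_iff)
qed

lemma b_notin_N: "b \<notin> N"
  using b_mem unfolding N_def by (simp add: mem_normalizer_in_iff)

lemma A_subset_N: "a \<in> A \<Longrightarrow> a \<in> N"
  using conjugate_commuting commute_A by (auto simp: mem_N_iff)

lemma A_conjugate_A [simp]: "a \<in> A \<Longrightarrow> a' \<in> A \<Longrightarrow> a \<star> a' = a"
  by (simp add: conjugate_commuting commute_A)

lemma commutator_B [simp]: "x \<in> B \<Longrightarrow> y \<in> B \<Longrightarrow> commutator G x y \<in> A"
  using commutator_mem_derived [OF subgroup_B] derived_B by blast

lemma f_B [simp]: "a \<in> carrier G \<Longrightarrow> f a \<in> B"
proof -
  assume a: "a \<in> carrier G"
  then have "f a = (inv b \<star> a) \<otimes> b"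
    by (simp add: word_simps)
  then show ?thesis using a by simp
qed

section \<open>The intersection of A with its conjugate\<close>

lemma mem_D_iff: "d \<in> D \<longleftrightarrow> d \<in> A \<and> d \<star> inv b \<in> A"
  using mem_conj_set_iff [of A b d] by (auto simp: D_def subset_iff)

text \<open>Passing from \<open>b\<close> to \<open>inv b\<close> costs a double commutator. If
  [x, b] is in \<open>A\<close>, then conjugation by \<open>inv b\<close> changes \<open>x\<close>
  only by [x, b] and [[x, b], inv b], and the latter is in [B, B], hence in \<open>A\<close>. The
  converse exchanges \<open>b\<close> and \<open>inv b\<close>.\<close>

lemma mem_D_iff': "d \<in> D \<longleftrightarrow> d \<in> A \<and> d \<star> b \<in> A"
proof -
  have D: "x \<star> inv b \<in> A" if x: "x \<in> A" "x \<star> b \<in> A" for x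
  proof -
    have "f x \<in> A" using x by (simp add: commutator_eq)
    moreover have "commutator G (f x) (inv b) \<in> A"
      using x by (intro commutator_B) simp_all
    ultimately have "f x \<otimes> commutator G (f x) (inv b) \<in> A"
      by simp
    moreover have "x \<star> inv b = x \<otimes> inv (f x \<otimes> commutator G (f x) (inv b))"
      using x by (simp add: word_simps)
    ultimately show ?thesis using x by simp
  qed
  have D': "x \<star> b \<in> A" if x: "x \<in> A" "x \<star> inv b \<in> A" for x
  proof -
    let ?y = "commutator G x (inv b)"
    have y: "?y \<in> A" using x by (simp add: commutator_eq)
    have "?y = (b \<star> x) \<otimes> inv b"
      using x by (simp add: word_simps)
    then have "?y \<in> B" using x by simp
    then have "commutator G ?y b \<in> A"
      by (intro commutator_B) simp_all
    then have "?y \<otimes> commutator G ?y b \<in> A"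
      using y by simp
    moreover have "x \<star> b = x \<otimes> inv (?y \<otimes> commutator G ?y b)"
      using x by (simp add: word_simps)
    ultimately show ?thesis using x by simp
  qed
  show ?thesis using D D' by (auto simp: mem_D_iff)
qed

lemma D_A: "d \<in> D \<Longrightarrow> d \<in> A"
  by (simp add: mem_D_iff)

lemma D_carrier [simp]: "d \<in> D \<Longrightarrow> d \<in> carrier G"
  by (simp add: D_A)

lemma subgroup_D: "subgroup D G"
proof (rule subgroupI)
  have "\<one> \<in> D" by (simp add: mem_D_iff)
  then show "D \<noteq> {}" by blast
qed (auto simp: mem_D_iff conjugate_mult conjugate_inv)

lemma D_closed [simp]:
  "x \<in> D \<Longrightarrow> y \<in> D \<Longrightarrow> x \<otimes> y \<in> D" "x \<in> D \<Longrightarrow> inv x \<in> D" "\<one> \<in> D"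
  using subgroup_D by (auto intro: subgroup.m_closed subgroup.m_inv_closed subgroup.one_closed)

lemma finite_D: "finite D"
  using finite_A by (rule finite_subset [rotated]) (auto simp: D_A)

text \<open>The kernel of \<open>f\<close> modulo \<open>A\<close> is \<open>D\<close>, because
  \<open>a \<star> b\<close> is \<open>a\<close> times \<open>f a\<close>.\<close>

lemma mem_D_iff_commutator: "a \<in> A \<Longrightarrow> a \<in> D \<longleftrightarrow> f a \<in> A"
proof -
  assume a: "a \<in> A"
  have "a \<star> b = a \<otimes> f a" "f a = inv a \<otimes> (a \<star> b)"
    using a by (simp_all add: commutator_eq)
  then show ?thesis
    using a unfolding mem_D_iff' by (metis A_closed)
qed

text \<open>Here [a, b] lies in [B, B] and so in \<open>A\<close>. In particular [B, B] itself falls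
  into \<open>D\<close>.\<close>

lemma AB_D: "a \<in> A \<Longrightarrow> a \<in> B \<Longrightarrow> a \<in> D"
  by (simp add: mem_D_iff_commutator)

lemma commutator_B_D [simp]: "x \<in> B \<Longrightarrow> y \<in> B \<Longrightarrow> commutator G x y \<in> D"
  using commutator_eq [of x y] by (intro AB_D commutator_B) simp_all

lemma derived_D: "derived G B \<subseteq> D"
  using derived_B derived_incl [OF order_refl subgroup_B] AB_D by blast

lemma D_conjugate_b:
  assumes "d \<in> D"
  shows "d \<star> b \<in> D"
proof -
  have "d \<in> A" "d \<star> b \<in> A"
    using assms mem_D_iff' by blast+
  then show ?thesis by (simp add: mem_D_iff)
qed

text \<open>Conjugating by \<open>inv b\<close> carries \<open>n\<close> to another element of
  \<open>N\<close>, so both membership conditions of \<open>D\<close> survive.\<close>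

lemma D_conjugate_N:
  assumes "d \<in> D" "n \<in> N"
  shows "d \<star> n \<in> D"
proof -
  have "d \<star> n \<star> inv b = d \<star> inv b \<star> (n \<star> inv b)"
    using assms by (simp add: word_simps)
  then show ?thesis
    using assms mem_D_iff [of d] mem_D_iff [of "d \<star> n"] by simp
qed

section \<open>Class two: D is central and f is multiplicative modulo D\<close>

lemma D_commute_A: "d \<in> D \<Longrightarrow> a \<in> A \<Longrightarrow> d \<otimes> a = a \<otimes> d"
  by (simp add: commute_A D_A)

text \<open>Both elements lie in the conjugate of \<open>A\<close> by \<open>b\<close>, which is
  abelian like \<open>A\<close>.\<close>

lemma D_commute_conjugate:
  assumes "d \<in> D" "a \<in> A"
  shows "d \<otimes> (a \<star> b) = (a \<star> b) \<otimes> d"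
proof -
  have "(d \<star> inv b \<otimes> a) \<star> b = (a \<otimes> d \<star> inv b) \<star> b"
    using assms commute_A [of "d \<star> inv b" a] mem_D_iff [of d] by simp
  then show ?thesis
    using assms by (simp add: conjugate_mult)
qed

lemma D_commute_f:
  assumes "d \<in> D" "a \<in> A"
  shows "d \<otimes> f a = f a \<otimes> d"
proof -
  have "d \<otimes> f a = inv a \<otimes> (d \<otimes> (a \<star> b))"
    using assms D_commute_A [of d "inv a"] mult_left_commute_commuting [of d "inv a" "a \<star> b"]
    by (simp add: commutator_eq)
  then show ?thesis
    using assms by (simp add: D_commute_conjugate commutator_eq m_assoc)
qed

text \<open>\<open>[a\<^sup>b, a']\<close> lies in \<open>A \<inter> A\<^sup>b\<close> since \<open>A\<close> and \<open>A\<^sup>b\<close> normalize each other.\<close>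
lemma commutator_conjugate_D:
  assumes "a \<in> A" "a' \<in> A"
  shows "commutator G (a \<star> b) a' \<in> D"
proof -
  have "a \<star> b \<in> N" using assms A_subset_N by simp
  then have "inv (a' \<star> (a \<star> b)) \<otimes> a' \<in> A"
    using assms by simp
  moreover have "commutator G (a \<star> b) a' = inv (a' \<star> (a \<star> b)) \<otimes> a'"
    using assms by (simp add: word_simps)
  moreover have "commutator G (a \<star> b) a' \<star> inv b = inv a \<otimes> (a \<star> (a' \<star> inv b))"
    using assms by (simp add: word_simps)
  moreover have "inv a \<otimes> (a \<star> (a' \<star> inv b)) \<in> A"
    using assms A_subset_N by simp
  ultimately show ?thesis
    by (simp add: mem_D_iff)
qed

text \<open>\<open>f a\<close> is \<open>inv a\<close> times \<open>a \<star> b\<close>, and the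
  first factor commutes with \<open>a'\<close>.\<close>

lemma commutator_f_A:
  assumes "a \<in> A" "a' \<in> A"
  shows "commutator G (f a) a' = commutator G (a \<star> b) a'"
proof -
  have "a \<star> a' = a" using assms by simp
  then have *: "inv a \<star> a' = inv a"
    using assms by simp
  have "commutator G (f a) a' = inv (a \<star> b) \<otimes> (a \<otimes> (inv a \<star> a' \<otimes> (a \<star> b \<star> a')))"
    using assms by (simp add: commutator_eq conjugate_mult inv_mult_group m_assoc del: A_conjugate_A)
  then show ?thesis
    using assms by (simp add: * commutator_eq)
qed

lemma f_A_commute:
  assumes "a \<in> A" "a' \<in> A"
  shows "f a \<otimes> a' = commutator G (a \<star> b) a' \<otimes> (a' \<otimes> f a)"
proof -
  have k: "commutator G (a \<star> b) a' \<in> D" using assms by (rule commutator_conjugate_D)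
  have "f a \<otimes> a' = a' \<otimes> f a \<otimes> commutator G (f a) a'"
    using assms by (simp add: word_simps)
  also have "\<dots> = commutator G (a \<star> b) a' \<otimes> (a' \<otimes> f a)"
    using assms k D_commute_f [OF k assms(1)] D_commute_A [OF k assms(2)]
      mult_left_commute_commuting [of "commutator G (a \<star> b) a'" a' "f a"]
    by (simp add: commutator_f_A m_assoc)
  finally show ?thesis .
qed

text \<open>From [aa', b] = [a, b]^a' [a', b]. The correction factor is in \<open>D\<close> by
  \<open>commutator_conjugate_D\<close>, so \<open>f\<close> is a homomorphism modulo
  \<open>D\<close>.\<close>

lemma f_mult:
  assumes "a \<in> A" "a' \<in> A"
  shows "f (a \<otimes> a') = commutator G (a \<star> b) a' \<otimes> (f a \<otimes> f a')"
proof -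
  have "f (a \<otimes> a') = inv a' \<otimes> (f a \<otimes> a') \<otimes> f a'"
    using assms by (simp add: word_simps)
  also have "\<dots> = inv a' \<otimes> commutator G (a \<star> b) a' \<otimes> a' \<otimes> (f a \<otimes> f a')"
    using assms by (simp add: f_A_commute m_assoc)
  also have "\<dots> = commutator G (a \<star> b) a' \<otimes> (f a \<otimes> f a')"
    using assms D_commute_A [OF commutator_conjugate_D [OF assms], of a'] by (simp add: m_assoc)
  finally show ?thesis .
qed

lemma odd_order_involution:
  assumes "odd (order G)" "v \<in> carrier G" "v \<otimes> v = \<one>"
  shows "v = \<one>"
proof -
  have "v [^] (2::nat) = \<one>" using assms by (simp add: numeral_2_eq_2)
  then have "ord v dvd 2" using assms pow_eq_id by blast
  moreover have "ord v dvd order G" using assms by (simp add: ord_dvd_group_order)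
  ultimately have "ord v dvd 1"
    using assms(1) by (metis coprime_common_divisor coprime_left_2_iff_odd nat_dvd_1_iff_1)
  then have "ord v = 1" by simp
  then show ?thesis using assms(2) ord_eq_1 by blast
qed

text \<open>
  Conjugating \<open>[a, a'] = 1\<close> by \<open>b\<close> and by \<open>b\<^sup>-\<^sup>1\<close> shows that \<open>[[a, b], [a', b]]\<close> equals its own inverse.
\<close>
lemma f_commute:
  assumes a: "a \<in> A" and c: "c \<in> A"
  shows "f a \<otimes> f c = f c \<otimes> f a"
proof (cases "odd (order G)")
  case False
  then show ?thesis using odd_or_abelian assms by auto
next
  case True
  define x y where "x = f a" and "y = f c"
  \<comment> \<open>\<open>s\<close> and \<open>t\<close> measure how \<open>a\<close> passes
    \<open>y\<close> and how \<open>c\<close> passes \<open>x\<close>. The inverses inside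
    \<open>v\<close> let the same element measure both how \<open>x\<close> passes \<open>y\<close>
    and how \<open>inv x\<close> passes \<open>inv y\<close>.\<close>
  define s t v where "s = inv (commutator G (c \<star> b) a)" and "t = inv (commutator G (a \<star> b) c)"
    and "v = commutator G (inv x) (inv y)"
  have [simp]: "a \<in> carrier G" "c \<in> carrier G" "x \<in> carrier G" "y \<in> carrier G" "x \<in> B" "y \<in> B"
    using a c by (simp_all add: x_def y_def)
  have D: "s \<in> D" "t \<in> D" "v \<in> D"
    using a c by (simp_all add: s_def t_def v_def commutator_conjugate_D)
  have [simp]: "s \<in> carrier G" "t \<in> carrier G" "v \<in> carrier G"
    using D by simp_all
  have inv_comm: "inv z \<otimes> w = w \<otimes> inv z"
    if "z \<otimes> w = w \<otimes> z" "z \<in> carrier G" "w \<in> carrier G" for z w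
    using that by (metis inv_closed inv_solve_left' inv_solve_right' m_assoc m_closed)
  have central: "d \<otimes> z = z \<otimes> d"
    if "d \<in> D" "z \<in> {a, c, x, y, inv x, inv y} \<union> D" for d z
  proof -
    have *: "d \<otimes> f w = f w \<otimes> d" "d \<otimes> inv (f w) = inv (f w) \<otimes> d" if "w \<in> A" for w
      using \<open>d \<in> D\<close> that D_commute_f inv_comm [of "f w" d] by simp_all
    show ?thesis
      using that a c * D_commute_A [of d] D_A by (auto simp: x_def y_def)
  qed
  have x: "c \<otimes> x = t \<otimes> (x \<otimes> c)"
    using f_A_commute [OF a c] commutator_conjugate_D [OF a c] a c by (simp add: t_def x_def)
  have y: "a \<otimes> y = s \<otimes> (y \<otimes> a)"
    using f_A_commute [OF c a] commutator_conjugate_D [OF c a] a c by (simp add: s_def y_def)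
  have v: "x \<otimes> y = v \<otimes> (y \<otimes> x)"
    by (simp add: v_def word_simps)
  have "(a \<star> b) \<otimes> (c \<star> b) = (c \<star> b) \<otimes> (a \<star> b)"
    using a c commute_A [of a c] by (simp flip: conjugate_mult)
  then have eq: "(a \<otimes> x) \<otimes> (c \<otimes> y) = (c \<otimes> y) \<otimes> (a \<otimes> x)"
    using a c by (simp add: conjugate_eq_mult_commutator x_def y_def)
  \<comment> \<open>First relation, from the commuting conjugates of \<open>a\<close> and
    \<open>c\<close> under \<open>b\<close>.\<close>
  have 1: "v \<otimes> s = t"
    by (rule central_commutator_relation [OF _ _ y x v central central central])
      (use a c D eq commute_A [of a c] in auto)
  \<comment> \<open>Replacing \<open>x\<close> and \<open>y\<close> by their inverses inverts
    \<open>t\<close> and \<open>s\<close> but keeps \<open>v\<close>.\<close>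
  have x': "c \<otimes> inv x = inv t \<otimes> (inv x \<otimes> c)"
  proof -
    have "inv x \<otimes> (t \<otimes> (x \<otimes> c)) \<otimes> inv x = inv x \<otimes> (c \<otimes> x) \<otimes> inv x"
      using x by simp
    then have "inv x \<otimes> (t \<otimes> (x \<otimes> (c \<otimes> inv x))) = inv x \<otimes> c"
      by (simp add: m_assoc)
    moreover have "t \<otimes> (x \<otimes> (c \<otimes> inv x)) = x \<otimes> (t \<otimes> (c \<otimes> inv x))"
      using central [OF D(2), of x] by (intro mult_left_commute_commuting) simp_all
    ultimately have "t \<otimes> (c \<otimes> inv x) = inv x \<otimes> c"
      by simp
    then show ?thesis
      by (metis \<open>c \<in> carrier G\<close> \<open>t \<in> carrier G\<close> \<open>x \<in> carrier G\<close> inv_closed inv_mult_cancel(2) m_closed)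
  qed
  have y': "a \<otimes> inv y = inv s \<otimes> (inv y \<otimes> a)"
  proof -
    have "inv y \<otimes> (s \<otimes> (y \<otimes> a)) \<otimes> inv y = inv y \<otimes> (a \<otimes> y) \<otimes> inv y"
      using y by simp
    then have "inv y \<otimes> (s \<otimes> (y \<otimes> (a \<otimes> inv y))) = inv y \<otimes> a"
      by (simp add: m_assoc)
    moreover have "s \<otimes> (y \<otimes> (a \<otimes> inv y)) = y \<otimes> (s \<otimes> (a \<otimes> inv y))"
      using central [OF D(1), of y] by (intro mult_left_commute_commuting) simp_all
    ultimately have "s \<otimes> (a \<otimes> inv y) = inv y \<otimes> a"
      by simp
    then show ?thesis
      by (metis \<open>a \<in> carrier G\<close> \<open>s \<in> carrier G\<close> \<open>y \<in> carrier G\<close> inv_closed inv_mult_cancel(2) m_closed)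
  qed
  have v': "inv x \<otimes> inv y = v \<otimes> (inv y \<otimes> inv x)"
  proof -
    have "inv x \<otimes> inv y = inv y \<otimes> inv x \<otimes> v"
      by (simp add: v_def word_simps)
    then show ?thesis
      using central [OF D(3), of "inv x"] central [OF D(3), of "inv y"]
        mult_left_commute_commuting [of v "inv y" "inv x"] by (simp add: m_assoc)
  qed
  \<comment> \<open>Conjugates under \<open>inv b\<close> equal \<open>a \<otimes> inv x\<close> and
    \<open>c \<otimes> inv y\<close> only up to commutators of elements of \<open>B\<close>; these
    lie in \<open>D\<close>, commute with all factors and can be cancelled.\<close>
  define z w where "z = commutator G (inv x) (inv b)" and "w = commutator G (inv y) (inv b)"
  have zw: "z \<in> D" "w \<in> D"
    by (simp_all add: z_def w_def)
  have [simp]: "z \<in> carrier G" "w \<in> carrier G"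
    using zw by simp_all
  have "a \<star> inv b = (a \<otimes> inv x) \<otimes> z" "c \<star> inv b = (c \<otimes> inv y) \<otimes> w"
    using a c by (simp_all add: x_def y_def z_def w_def word_simps)
  moreover have "(a \<star> inv b) \<otimes> (c \<star> inv b) = (c \<star> inv b) \<otimes> (a \<star> inv b)"
    using a c commute_A [of a c] by (simp flip: conjugate_mult)
  ultimately have "((a \<otimes> inv x) \<otimes> z) \<otimes> ((c \<otimes> inv y) \<otimes> w) = ((c \<otimes> inv y) \<otimes> w) \<otimes> ((a \<otimes> inv x) \<otimes> z)"
    by simp
  then have eq': "(a \<otimes> inv x) \<otimes> (c \<otimes> inv y) = (c \<otimes> inv y) \<otimes> (a \<otimes> inv x)"
    by (rule commuting_cancel_right [rotated -1])
      (use a c zw central in \<open>auto intro!: commuting_mult\<close>)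
  \<comment> \<open>Second relation, from conjugation by \<open>inv b\<close>. Eliminating
    \<open>s\<close> and \<open>t\<close> between the two relations leaves
    \<open>inv v = v\<close>.\<close>
  have "v \<otimes> inv s = inv t"
    by (rule central_commutator_relation [OF _ _ y' x' v' central central central])
      (use a c D eq' commute_A [of a c] in auto)
  moreover have "s \<otimes> inv t = inv v"
    using 1 by (metis \<open>s \<in> carrier G\<close> \<open>v \<in> carrier G\<close> inv_closed inv_mult_group inv_mult_cancel(1))
  moreover have "s \<otimes> (v \<otimes> inv s) = v"
    using central [OF D(3), of s] D mult_left_commute_commuting [of v s "inv s"] by simp
  ultimately have "inv v = v"
    by simp
  then have "v \<otimes> v = \<one>"
    using r_inv [of v] \<open>v \<in> carrier G\<close> by metis
  then have "v = \<one>" by (rule odd_order_involution [OF True \<open>v \<in> carrier G\<close>])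
  then show ?thesis using v by (simp add: x_def y_def)
qed

section \<open>The replacement subgroup in explicit form\<close>

definition T :: "'a set" where
  "T = {d \<otimes> f a | d a. d \<in> D \<and> a \<in> A}"

lemma T_I: "d \<in> D \<Longrightarrow> a \<in> A \<Longrightarrow> d \<otimes> f a \<in> T"
  by (auto simp: T_def)

lemma T_E:
  assumes "y \<in> T"
  obtains d a where "d \<in> D" "a \<in> A" "y = d \<otimes> f a"
  using assms by (auto simp: T_def)

lemma T_carrier [simp]: "y \<in> T \<Longrightarrow> y \<in> carrier G"
  by (elim T_E) simp

lemma finite_T: "finite T"
  using finite_carrier by (rule finite_subset [rotated]) auto

lemma f_one [simp]: "f \<one> = \<one>"
  by (simp add: word_simps)

lemma D_T: "d \<in> D \<Longrightarrow> d \<in> T"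
  using T_I [of d \<one>] by simp

lemma f_T: "a \<in> A \<Longrightarrow> f a \<in> T"
  using T_I [of \<one> a] by simp

lemma T_mult_form:
  assumes "d \<in> D" "a \<in> A" "d' \<in> D" "a' \<in> A"
  shows "(d \<otimes> f a) \<otimes> (d' \<otimes> f a') = (d \<otimes> d' \<otimes> inv (commutator G (a \<star> b) a')) \<otimes> f (a \<otimes> a')"
proof -
  have "(d \<otimes> f a) \<otimes> (d' \<otimes> f a') = d \<otimes> d' \<otimes> (f a \<otimes> f a')"
    using assms D_commute_f [of d' a] mult_left_commute_commuting [of d' "f a" "f a'"]
    by (simp add: m_assoc)
  then show ?thesis
    using assms by (simp add: f_mult m_assoc)
qed

lemma T_mult: "x \<in> T \<Longrightarrow> y \<in> T \<Longrightarrow> x \<otimes> y \<in> T"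
  by (elim T_E) (auto simp: T_mult_form commutator_conjugate_D intro!: T_I)

lemma T_commute: "x \<in> T \<Longrightarrow> y \<in> T \<Longrightarrow> x \<otimes> y = y \<otimes> x"
proof (elim T_E)
  fix d a d' a' assume *: "d \<in> D" "a \<in> A" "x = d \<otimes> f a" "d' \<in> D" "a' \<in> A" "y = d' \<otimes> f a'"
  have "d \<otimes> (d' \<otimes> f a') = (d' \<otimes> f a') \<otimes> d" "f a \<otimes> (d' \<otimes> f a') = (d' \<otimes> f a') \<otimes> f a"
    using * D_commute_f [of d' a] D_commute_f [of d a'] D_commute_A [of d d'] f_commute [of a a']
    by (auto intro!: commuting_mult simp: D_A)
  then show "x \<otimes> y = y \<otimes> x"
    using * commuting_mult [of "d' \<otimes> f a'" d "f a"] by simp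
qed

text \<open>Multiplicativity modulo \<open>D\<close>, applied to \<open>a\<close> and
  \<open>inv a\<close>.\<close>

lemma f_inv:
  assumes "a \<in> A"
  obtains k where "k \<in> D" "f (inv a) = k \<otimes> inv (f a)"
proof -
  let ?k = "commutator G (a \<star> b) (inv a)"
  have k: "?k \<in> D" using assms by (simp add: commutator_conjugate_D)
  have "\<one> = ?k \<otimes> (f a \<otimes> f (inv a))"
    using f_mult [of a "inv a"] assms by simp
  also have "\<dots> = f a \<otimes> (?k \<otimes> f (inv a))"
    using assms k D_commute_f [OF k assms] by (intro mult_left_commute_commuting [symmetric]) simp_all
  finally have "f a \<otimes> (?k \<otimes> f (inv a)) = \<one>" ..
  then have "inv (f a) = ?k \<otimes> f (inv a)"
    using assms k by (intro inv_equality [OF inv_comm]) simp_all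
  then have "f (inv a) = inv ?k \<otimes> inv (f a)"
    using assms k by simp
  with k show thesis using that [of "inv ?k"] by simp
qed

lemma subgroup_T: "subgroup T G"
proof (rule subgroupI)
  show "T \<noteq> {}" using D_T [of \<one>] by auto
  fix y assume "y \<in> T"
  then obtain d a where y: "d \<in> D" "a \<in> A" "y = d \<otimes> f a" by (rule T_E)
  obtain k where k: "k \<in> D" "f (inv a) = k \<otimes> inv (f a)"
    using f_inv y(2) by blast
  then have "inv (f a) = inv k \<otimes> f (inv a)"
    using y by simp
  moreover have "inv k \<otimes> f (inv a) \<in> T"
    using y k by (intro T_I) simp_all
  ultimately have "inv (f a) \<in> T" by metis
  then show "inv y \<in> T"
    using y D_T [of "inv d"] by (simp add: inv_mult_group T_mult)
qed (auto simp: T_mult)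

text \<open>Since \<open>f\<close> is a homomorphism modulo \<open>D\<close>, the products
  \<open>d \<otimes> f a\<close> already form a subgroup; it therefore contains the subgroup
  generated by all commutators.\<close>

lemma star_eq: "star_subgroup G A b = T"
proof
  have "commutator_subgroup G A b \<subseteq> T"
    unfolding commutator_subgroup_def using f_T by (intro generate_subgroup_incl subgroup_T) auto
  then show "star_subgroup G A b \<subseteq> T"
    unfolding star_subgroup_def set_mult_def D_def [symmetric] using D_T T_mult by auto
  show "T \<subseteq> star_subgroup G A b"
    unfolding star_subgroup_def set_mult_def D_def [symmetric] commutator_subgroup_def
    by (auto elim!: T_E intro!: generate.incl)
qed

text \<open>A product in the wrong order can be rewritten as in \<open>swap\<close>: for
  \<open>y\<close> in \<open>A\<close> the element \<open>y \<star> inv b\<close> lies in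
  \<open>N\<close> and so normalizes \<open>A\<close>.\<close>

lemma subgroup_mult_conjugate: "subgroup (A <#> conj_set G A b) G"
proof (rule subgroupI)
  have mem: "x \<in> A <#> conj_set G A b \<longleftrightarrow> (\<exists>a\<in>A. \<exists>a'\<in>A. x = a \<otimes> (a' \<star> b))" for x
    unfolding set_mult_def conj_set_eq by blast
  have swap: "\<exists>a\<in>A. \<exists>a'\<in>A. (x \<star> b) \<otimes> y = a \<otimes> (a' \<star> b)" if "x \<in> A" "y \<in> A" for x y
  proof -
    have "x \<star> (y \<star> inv b) \<in> A"
      using that A_subset_N by simp
    moreover have "(x \<star> b) \<otimes> y = y \<otimes> (x \<star> (y \<star> inv b) \<star> b)"
      using that by (simp add: word_simps)
    ultimately show ?thesis using that by blast
  qed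
  show "A <#> conj_set G A b \<subseteq> carrier G"
    by (auto simp: mem)
  show "A <#> conj_set G A b \<noteq> {}"
    using A_closed(3) unfolding set_mult_def conj_set_eq by blast
  show "inv x \<in> A <#> conj_set G A b" if x: "x \<in> A <#> conj_set G A b" for x
  proof -
    obtain a a' where a: "a \<in> A" "a' \<in> A" "x = a \<otimes> (a' \<star> b)"
      using x unfolding mem by blast
    then have "inv x = (inv a' \<star> b) \<otimes> inv a"
      by (simp add: inv_mult_group conjugate_inv)
    then show ?thesis
      unfolding mem using swap [of "inv a'" "inv a"] a by simp
  qed
  show "x \<otimes> y \<in> A <#> conj_set G A b"
    if xy: "x \<in> A <#> conj_set G A b" "y \<in> A <#> conj_set G A b" for x y
  proof -
    obtain a a' c c' where a: "a \<in> A" "a' \<in> A" "x = a \<otimes> (a' \<star> b)"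
      "c \<in> A" "c' \<in> A" "y = c \<otimes> (c' \<star> b)"
      using xy unfolding mem by blast
    obtain e e' where e: "e \<in> A" "e' \<in> A" "(a' \<star> b) \<otimes> c = e \<otimes> (e' \<star> b)"
      using swap a by blast
    have "x \<otimes> y = a \<otimes> ((a' \<star> b) \<otimes> c) \<otimes> (c' \<star> b)"
      using a by (simp add: m_assoc)
    also have "\<dots> = (a \<otimes> e) \<otimes> ((e' \<otimes> c') \<star> b)"
      using a e by (simp add: m_assoc conjugate_mult)
    finally show ?thesis
      unfolding mem using a e by (intro bexI [of _ "a \<otimes> e"] bexI [of _ "e' \<otimes> c'"]) simp_all
  qed
qed

lemma T_subset_mult: "T \<subseteq> A <#> conj_set G A b"
proof
  fix y assume "y \<in> T"
  then obtain d a where y: "d \<in> D" "a \<in> A" "y = d \<otimes> f a" by (rule T_E)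
  then have "y = (d \<otimes> inv a) \<otimes> (a \<star> b)"
    by (simp add: commutator_eq m_assoc)
  then show "y \<in> A <#> conj_set G A b"
    using y D_A by (auto simp: set_mult_def conj_set_eq)
qed

section \<open>Order, torsion and exponent of T\<close>

lemma f_quotient:
  assumes "a \<in> A" "a' \<in> A"
  obtains k where "k \<in> D" "f (a \<otimes> inv a') = k \<otimes> (f a \<otimes> inv (f a'))"
proof -
  obtain k' where k': "k' \<in> D" "f (inv a') = k' \<otimes> inv (f a')"
    using f_inv assms by blast
  let ?k = "commutator G (a \<star> b) (inv a')"
  have k: "?k \<in> D" using assms by (simp add: commutator_conjugate_D)
  have "f (a \<otimes> inv a') = ?k \<otimes> (f a \<otimes> (k' \<otimes> inv (f a')))"
    using assms k' by (simp add: f_mult)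
  also have "\<dots> = (?k \<otimes> k') \<otimes> (f a \<otimes> inv (f a'))"
    using assms k k' D_commute_f [OF k'(1) assms(1)]
      mult_left_commute_commuting [of k' "f a" "inv (f a')"] by (simp add: m_assoc)
  finally show thesis
    by (rule that [rotated]) (use k k' in simp)
qed

text \<open>\<open>f\<close> separates the cosets of \<open>D\<close>: one direction is the
  invariance of \<open>D\<close> under \<open>b\<close>, the other is
  \<open>mem_D_iff_commutator\<close>.\<close>

lemma quotient_mem_D_iff:
  assumes "a \<in> A" "a' \<in> A"
  shows "a \<otimes> inv a' \<in> D \<longleftrightarrow> f a \<otimes> inv (f a') \<in> D"
proof -
  obtain k where k: "k \<in> D" "f (a \<otimes> inv a') = k \<otimes> (f a \<otimes> inv (f a'))"
    using f_quotient assms by blast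
  have "a \<otimes> inv a' \<in> D \<longleftrightarrow> f (a \<otimes> inv a') \<in> D"
  proof
    assume "a \<otimes> inv a' \<in> D"
    then show "f (a \<otimes> inv a') \<in> D"
      using D_conjugate_b by (simp add: commutator_eq)
  qed (use assms D_A in \<open>simp add: mem_D_iff_commutator\<close>)
  also have "\<dots> \<longleftrightarrow> f a \<otimes> inv (f a') \<in> D"
  proof
    assume "f (a \<otimes> inv a') \<in> D"
    then have "inv k \<otimes> (k \<otimes> (f a \<otimes> inv (f a'))) \<in> D"
      using k by (simp del: inv_mult_cancel)
    then show "f a \<otimes> inv (f a') \<in> D" using k assms by simp
  qed (use k in simp)
  finally show ?thesis .
qed

text \<open>The counting lemma is applied modulo the elements of \<open>D\<close> killed by
  \<open>n\<close>: a quotient of two elements of \<open>A\<close> killed by \<open>n\<close> is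
  again killed by \<open>n\<close>. The free target \<open>Y\<close> allows both \<open>T\<close>
  and its torsion.\<close>

lemma card_torsion_le:
  assumes Y: "finite Y"
    and DY: "\<And>d a. d \<in> D \<Longrightarrow> a \<in> A \<Longrightarrow> d [^] n = \<one> \<Longrightarrow> a [^] n = \<one> \<Longrightarrow> d \<otimes> f a \<in> Y"
  shows "card {a \<in> A. a [^] (n::nat) = \<one>} \<le> card Y"
proof (rule card_le_modulo_subgroup [of "{d \<in> D. d [^] n = \<one>}" Y _ f])
  have comm: "x \<otimes> y = y \<otimes> x" if "x \<in> D" "y \<in> D" for x y
    using that D_commute_A D_A by simp
  show "subgroup {d \<in> D. d [^] n = \<one>} G"
  proof (rule subgroupI)
    show "{d \<in> D. d [^] n = \<one>} \<noteq> {}"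
      using D_closed(3) nat_pow_one by blast
  qed (auto simp: nat_pow_inv pow_mult_distrib comm)
  show "x \<otimes> inv x' \<in> {d \<in> D. d [^] n = \<one>}"
    if "x \<in> {a \<in> A. a [^] n = \<one>}" "x' \<in> {a \<in> A. a [^] n = \<one>}"
      "f x \<otimes> inv (f x') \<in> {d \<in> D. d [^] n = \<one>}" for x x'
    using that quotient_mem_D_iff [of x x'] commute_A [of x "inv x'"]
    by (simp add: pow_mult_distrib nat_pow_inv)
qed (use Y DY finite_D in \<open>auto intro: finite_subset\<close>)

lemma card_T: "card T = card A"
proof (rule antisym)
  \<comment> \<open>\<open>g\<close> picks the \<open>A\<close>-component of some representation of
    an element of \<open>T\<close>, a section of \<open>f\<close> modulo \<open>D\<close>.\<close>
  define g where "g y = (SOME a. a \<in> A \<and> (\<exists>d\<in>D. y = d \<otimes> f a))" for y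
  have g: "g y \<in> A \<and> (\<exists>d\<in>D. y = d \<otimes> f (g y))" if "y \<in> T" for y
    unfolding g_def by (rule someI_ex) (use that in \<open>blast elim: T_E\<close>)
  show "card T \<le> card A"
  proof (rule card_le_modulo_subgroup [OF subgroup_D finite_D finite_A, of T g])
    fix y y' assume y: "y \<in> T" "y' \<in> T" and gD: "g y \<otimes> inv (g y') \<in> D"
    obtain d d' where d: "d \<in> D" "y = d \<otimes> f (g y)" "d' \<in> D" "y' = d' \<otimes> f (g y')"
      using g y by metis
    have gA: "g y \<in> A" "g y' \<in> A" using g y by blast+
    have "f (g y) \<otimes> inv (f (g y')) \<in> D"
      using quotient_mem_D_iff [OF gA] gD by simp
    then have "d \<otimes> (f (g y) \<otimes> inv (f (g y'))) \<otimes> inv d' \<in> D"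
      using d by simp
    moreover have "d \<otimes> (f (g y) \<otimes> inv (f (g y'))) \<otimes> inv d' = (d \<otimes> f (g y)) \<otimes> inv (d' \<otimes> f (g y'))"
      using d(1,3) gA by (simp add: m_assoc inv_mult_group)
    ultimately show "y \<otimes> inv y' \<in> D"
      using d by metis
  qed (use g D_A in auto)
  \<comment> \<open>The group order kills every element, so this torsion count covers all of
    \<open>A\<close>.\<close>
  have "card {a \<in> A. a [^] order G = \<one>} \<le> card T"
    using finite_T T_I by (rule card_torsion_le)
  moreover have "{a \<in> A. a [^] order G = \<one>} = A"
    by (auto simp: pow_order_eq_1)
  ultimately show "card A \<le> card T" by simp
qed

text \<open>\<open>f a\<close> is the product of \<open>inv a\<close> and
  \<open>a \<star> b\<close>, both killed by \<open>n\<close>. Their commutator \<open>?k\<close>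
  commutes with both and is killed by \<open>n\<close>, and for odd \<open>n\<close> the collection
  exponent n(n-1)/2 is a multiple of \<open>n\<close>.\<close>

lemma f_pow_odd:
  assumes a: "a \<in> A" "a [^] n = \<one>" and n: "odd (n::nat)"
  shows "f a [^] n = \<one>"
proof -
  let ?w = "a \<star> b"
  let ?k = "commutator G ?w (inv a)"
  have k: "?k \<in> D" using a by (simp add: commutator_conjugate_D)
  have kw: "?k \<otimes> ?w = ?w \<otimes> ?k" and ka: "?k \<otimes> inv a = inv a \<otimes> ?k"
    using D_commute_conjugate [OF k a(1)] D_commute_A [OF k, of "inv a"] a by simp_all
  have wn: "?w [^] n = \<one>" "inv a [^] n = \<one>"
    using a by (simp_all add: conjugate_pow nat_pow_inv)
  \<comment> \<open>As a conjugate of \<open>?w\<close>, the product \<open>?w \<otimes> ?k\<close>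
    is killed by \<open>n\<close> too; this forces \<open>?k [^] n = \<one>\<close>.\<close>
  have "?w \<star> inv a = ?w \<otimes> ?k" using a by (simp add: conjugate_eq_mult_commutator)
  moreover have "(?w \<star> inv a) [^] n = \<one>"
    using a wn by (simp add: conjugate_pow)
  moreover have "(?w \<otimes> ?k) [^] n = ?w [^] n \<otimes> ?k [^] n"
    using a k kw by (intro pow_mult_distrib) simp_all
  ultimately have kn: "?k [^] n = \<one>"
    using k wn by simp
  have "?w \<otimes> inv a = ?k \<otimes> (inv a \<otimes> ?w)"
  proof -
    have "?w \<otimes> inv a = inv a \<otimes> ?w \<otimes> ?k"
      using a by (simp add: word_simps)
    then show ?thesis
      using a k kw ka mult_left_commute_commuting [of ?k "inv a" ?w] by (simp add: m_assoc)
  qed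
  then have "(inv a \<otimes> ?w) [^] n = ?k [^] (n * (n - 1) div 2) \<otimes> (inv a [^] n \<otimes> ?w [^] n)"
    using a k kw ka by (intro pow_mult_class2) simp_all
  moreover have "n * (n - 1) div 2 = n * ((n - 1) div 2)"
    using n by (simp add: div_mult_swap)
  moreover have "?k [^] (n * ((n - 1) div 2)) = \<one>"
    using a k kn by (simp flip: nat_pow_pow)
  ultimately show ?thesis
    using a wn by (simp add: commutator_eq)
qed

lemma T_pow_odd:
  assumes "d \<in> D" "a \<in> A" "d [^] n = \<one>" "a [^] n = \<one>" "odd (n::nat)"
  shows "(d \<otimes> f a) [^] n = \<one>"
  using assms pow_mult_distrib [OF D_commute_f] f_pow_odd by simp

lemma card_odd_torsion_le:
  assumes "odd (n::nat)"
  shows "card {a \<in> A. a [^] n = \<one>} \<le> card {y \<in> T. y [^] n = \<one>}"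
  using assms finite_T by (intro card_torsion_le) (auto simp: T_pow_odd T_I)

text \<open>To apply \<open>T_pow_odd\<close>, the exponent has to be odd. Its gcd with the group
  order also kills \<open>A\<close>, so by minimality the exponent divides the odd group
  order.\<close>

lemma group_exponent_T_le:
  assumes "odd (order G)"
  shows "group_exponent G T \<le> group_exponent G A"
proof -
  let ?Q = "\<lambda>n. 0 < n \<and> (\<forall>a\<in>A. a [^] n = \<one>)"
  define n where "n = group_exponent G A"
  have pos: "order G > 0" using finite_carrier order_gt_0_iff_finite by blast
  then have "?Q (order G)" by (simp add: pow_order_eq_1)
  then have n: "?Q n"
    unfolding n_def group_exponent_def by (rule LeastI)
  have "?Q (gcd n (order G))"
    using n pos by (auto simp: pow_eq_id ord_dvd_group_order)
  then have "n \<le> gcd n (order G)"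
    unfolding n_def group_exponent_def by (rule Least_le)
  then have "n = gcd n (order G)"
    using n by (intro antisym) (auto simp: gcd_le1_nat)
  then have "odd n" using assms by (metis dvd_trans gcd_dvd2)
  then have "\<forall>y\<in>T. y [^] n = \<one>"
    using n D_A by (auto elim!: T_E intro!: T_pow_odd)
  then show ?thesis
    unfolding n_def [symmetric] using n unfolding group_exponent_def by (intro Least_le) simp
qed

section \<open>Normalizers and intersections with B\<close>

lemma T_subset_N: "y \<in> T \<Longrightarrow> y \<in> N"
proof (elim T_E)
  fix d a assume "d \<in> D" "a \<in> A" "y = d \<otimes> f a"
  then show "y \<in> N"
    using D_A A_subset_N by (simp add: commutator_eq)
qed

text \<open>For \<open>n \<in> N\<close> we have \<open>b\<^sup>n = bm\<close> with \<open>m \<in> B \<inter> N\<close>, and \<open>[a, bm] = [a, m][a, b]\<^sup>m\<close>.\<close>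
lemma T_conjugate_N:
  assumes "y \<in> T" "n \<in> N"
  shows "y \<star> n \<in> T"
proof -
  obtain d a where y: "d \<in> D" "a \<in> A" "y = d \<otimes> f a" using assms by (elim T_E)
  \<comment> \<open>Conjugation by \<open>n\<close> carries [a, b] to [c, bm].\<close>
  define m c where "m = inv b \<otimes> (b \<star> n)" and "c = a \<star> n"
  have c: "c \<in> A" using y assms by (simp add: c_def)
  have mB: "m \<in> B" using assms by (simp add: m_def)
  \<comment> \<open>Grouped this way, \<open>m\<close> is visibly in \<open>N\<close>, because
    \<open>b\<close> normalizes \<open>N\<close>.\<close>
  have "m = (inv n \<star> b) \<otimes> n" using assms by (simp add: m_def word_simps)
  then have mN: "m \<in> N" using assms by simp
  have "commutator G c m \<in> A" using c mN by (simp add: commutator_eq)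
  moreover have "commutator G c m \<in> B"
  proof -
    have "commutator G c m = (inv m \<star> c) \<otimes> m" using c mB by (simp add: word_simps)
    then show ?thesis using c mB by simp
  qed
  ultimately have cm: "commutator G c m \<in> D" by (rule AB_D)
  have fm: "commutator G (f c) m \<in> D" using c mB by (intro commutator_B_D) simp_all
  \<comment> \<open>The factor \<open>f c \<star> m\<close> is written as \<open>f c\<close> times a
    commutator of elements of \<open>B\<close>, which falls into \<open>D\<close>.\<close>
  have "f a \<star> n = commutator G c m \<otimes> (f c \<otimes> commutator G (f c) m)"
    using assms y by (simp add: m_def c_def word_simps)
  then have "f a \<star> n \<in> T"
    using cm fm c by (simp add: T_mult D_T f_T)
  then show ?thesis
    using y assms D_T D_conjugate_N by (simp add: conjugate_mult T_mult)
qed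

text \<open>Conjugation by \<open>b\<close> multiplies [a, b] by [[a, b], b], which is in [B, B] and
  hence in \<open>D\<close>.\<close>

lemma T_conjugate_b:
  assumes "y \<in> T"
  shows "y \<star> b \<in> T"
proof -
  obtain d a where y: "d \<in> D" "a \<in> A" "y = d \<otimes> f a" using assms by (elim T_E)
  then have "y \<star> b = (d \<star> b) \<otimes> (f a \<otimes> commutator G (f a) b)"
    by (simp add: conjugate_mult conjugate_eq_mult_commutator [of "f a" b])
  moreover have "commutator G (f a) b \<in> D" using y by (intro commutator_B_D) simp_all
  ultimately show ?thesis
    using y D_conjugate_b by (simp add: T_mult D_T f_T)
qed

lemma mem_normalizer_T_iff: "g \<in> normalizer_in G (carrier G) T \<longleftrightarrow> g \<in> carrier G \<and> (\<forall>y\<in>T. y \<star> g \<in> T)"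
  using conj_set_eq_iff [of T g] finite_T by (auto simp: mem_normalizer_in_iff subset_iff)

lemma normalizer_psubset: "N \<subset> normalizer_in G (carrier G) T"
proof
  show "N \<subseteq> normalizer_in G (carrier G) T"
    using T_conjugate_N by (auto simp: mem_normalizer_T_iff)
  have "b \<in> normalizer_in G (carrier G) T"
    using T_conjugate_b by (simp add: mem_normalizer_T_iff)
  then show "N \<noteq> normalizer_in G (carrier G) T" using b_notin_N by blast
qed

text \<open>As \<open>b\<close> does not normalize \<open>A\<close>, some [a, b] lies outside
  \<open>A\<close>; it lies in \<open>T\<close> and, since \<open>B\<close> is normal, in
  \<open>B\<close>.\<close>

lemma A_Int_B_psubset: "A \<inter> B \<subset> T \<inter> B"
proof
  show "A \<inter> B \<subseteq> T \<inter> B" using AB_D D_T by blast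
  obtain a where "a \<in> A" "a \<star> b \<notin> A"
    using b_notin_N mem_N_iff [of b] by auto
  then have "f a \<notin> A"
    using mem_D_iff_commutator mem_D_iff' by blast
  then show "A \<inter> B \<noteq> T \<inter> B"
    using f_T f_B \<open>a \<in> A\<close> by auto
qed

text \<open>The element \<open>b\<close> of \<open>B\<close> is missing from \<open>N\<close>, which
  contains \<open>T\<close>.\<close>

lemma T_Int_B_psubset: "T \<inter> B \<subset> B"
  using T_subset_N b_notin_N b_B by blast

end

section \<open>Existence of b and the properties of the replacement subgroup\<close>

theorem theorem3p1:
  fixes S :: "('a, 'b) monoid_scheme" (structure)
    and p :: nat and A B :: "'a set"
  assumes "Factorial_Ring.prime p"
    and "group S" and "finite (carrier S)" and "\<exists>n. order S = p ^ n"
    and "B \<lhd> S"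
    and "p = 2 \<Longrightarrow> comm_group (S\<lparr>carrier := B\<rparr>)"
    and "subgroup A S" and "comm_group (S\<lparr>carrier := A\<rparr>)"
    and "derived S B \<subseteq> A"
  shows "(normalizes S B A \<or>
          (\<exists>b. b \<in> normalizer_in S B (normalizer_in S (carrier S) A) - normalizer_in S B A)) \<and>
    (\<forall>b \<in> normalizer_in S B (normalizer_in S (carrier S) A) - normalizer_in S B A.
      subgroup (star_subgroup S A b) S \<and>
      subgroup (A <#> conj_set S A b) S \<and>
      star_subgroup S A b \<subseteq> A <#> conj_set S A b \<and>
      \<comment> \<open>(i)\<close>
      card (star_subgroup S A b) = card A \<and>
      \<comment> \<open>(ii)\<close>
      comm_group (S\<lparr>carrier := star_subgroup S A b\<rparr>) \<and>
      derived S B \<subseteq> star_subgroup S A b \<and>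
      \<comment> \<open>(iii)\<close>
      A \<inter> B \<subset> star_subgroup S A b \<inter> B \<and>
      star_subgroup S A b \<inter> B \<subset> B \<and>
      \<comment> \<open>(iv)\<close>
      normalizes S (star_subgroup S A b) A \<and>
      normalizes S A (star_subgroup S A b) \<and>
      \<comment> \<open>(v)\<close>
      b \<in> normalizer_in S (carrier S) (star_subgroup S A b) \<and>
      normalizer_in S (carrier S) A \<subset> normalizer_in S (carrier S) (star_subgroup S A b) \<and>
      \<comment> \<open>(vi)\<close>
      (p > 2 \<longrightarrow>
        (\<forall>i\<ge>1. omega S p i (star_subgroup S A b) \<ge> omega S p i A) \<and>
        group_exponent S (star_subgroup S A b) \<le> group_exponent S A \<and>
        group_rank S (star_subgroup S A b) \<ge> group_rank S A \<and>
        lex_ge S p (star_subgroup S A b) A))"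
proof -
  interpret group S by (fact assms(2))
  note p = assms(1) and fin = assms(3) and B = assms(5) and A = assms(7)
  obtain k where ord: "order S = p ^ k" using assms(4) by blast
  have Ac: "A \<subseteq> carrier S" and Bc: "B \<subseteq> carrier S"
    using A B by (simp_all add: subgroup.subset normal_imp_subgroup)
  let ?N = "normalizer_in S (carrier S) A"
  have "?N = carrier S \<inter> normalizer S A" "subgroup (normalizer S A) S"
    using Ac normalizer_in_eq_normalizer normalizer_imp_subgroup by simp_all
  then have N: "subgroup ?N S" by (simp add: Int_absorb1 subgroup.subset)
  have Nc: "?N \<subseteq> carrier S" using N by (rule subgroup.subset)
  have "\<exists>b. b \<in> normalizer_in S B ?N - normalizer_in S B A" if "\<not> normalizes S B A"
  proof -
    have "\<not> B \<subseteq> ?N"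
      using that by (auto simp: normalizes_def mem_normalizer_in_iff)
    then obtain b where b: "b \<in> B" "b \<notin> ?N" "\<And>n. n \<in> ?N \<Longrightarrow> conjugate n b \<in> ?N"
      using exists_normalizing_not_mem [OF fin p ord B N] by blast
    have "conj_set S ?N b = ?N"
      using conj_set_eq_iff [of ?N b] b Nc Bc finite_subset [OF Nc fin] by blast
    moreover have "conj_set S A b \<noteq> A"
      using b Bc by (auto simp: mem_normalizer_in_iff)
    ultimately show ?thesis
      using b by (auto simp: mem_normalizer_in_iff)
  qed
  moreover have "subgroup (star_subgroup S A b) S \<and>
      subgroup (A <#> conj_set S A b) S \<and>
      star_subgroup S A b \<subseteq> A <#> conj_set S A b \<and>
      card (star_subgroup S A b) = card A \<and>
      comm_group (S\<lparr>carrier := star_subgroup S A b\<rparr>) \<and>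
      derived S B \<subseteq> star_subgroup S A b \<and>
      A \<inter> B \<subset> star_subgroup S A b \<inter> B \<and>
      star_subgroup S A b \<inter> B \<subset> B \<and>
      normalizes S (star_subgroup S A b) A \<and>
      normalizes S A (star_subgroup S A b) \<and>
      b \<in> normalizer_in S (carrier S) (star_subgroup S A b) \<and>
      ?N \<subset> normalizer_in S (carrier S) (star_subgroup S A b) \<and>
      (p > 2 \<longrightarrow>
        (\<forall>i\<ge>1. omega S p i (star_subgroup S A b) \<ge> omega S p i A) \<and>
        group_exponent S (star_subgroup S A b) \<le> group_exponent S A \<and>
        group_rank S (star_subgroup S A b) \<ge> group_rank S A \<and>
        lex_ge S p (star_subgroup S A b) A)"
    if b: "b \<in> normalizer_in S B ?N - normalizer_in S B A" for b
  proof -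
    have odd_p: "odd (p ^ i)" if "p > 2" for i
      using that p by (simp add: prime_odd_nat)
    have odd: "odd (order S) \<or> (\<forall>x\<in>B. \<forall>y\<in>B. x \<otimes> y = y \<otimes> x)"
    proof (cases "p = 2")
      case True
      then show ?thesis using comm_groupE(4) [OF assms(6)] by simp
    next
      case False
      then have "p > 2" using prime_ge_2_nat [OF p] by simp
      then show ?thesis using odd_p ord by simp
    qed
    interpret replacement S A B b
      using assms(2) fin odd B A comm_groupE(4) [OF assms(8)] assms(9) b
      by (intro replacement.intro replacement_axioms.intro) simp_all
    have T_comm: "comm_group (S\<lparr>carrier := T\<rparr>)"
      using subgroup_imp_group [OF subgroup_T] T_commute
      by (intro group.group_comm_groupI) simp_all
    have conj_N: "conj_set S A n = A" if "n \<in> N" for n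
      using that by (simp add: N_def mem_normalizer_in_iff)
    have conj_T: "conj_set S T n = T" if "n \<in> N" for n
    proof -
      have "n \<in> normalizer_in S (carrier S) T"
        using that normalizer_psubset by blast
      then show ?thesis by (simp add: mem_normalizer_in_iff)
    qed
    have omega: "omega S p i A \<le> omega S p i T" if "p > 2" for i
      using card_odd_torsion_le [OF odd_p [OF that]] omega_eq_card [OF p ord A assms(8)]
        omega_eq_card [OF p ord subgroup_T T_comm] by simp
    have rank: "group_rank S A \<le> group_rank S T" if "p > 2"
    proof -
      \<comment> \<open>The torsion count for exponent p, since both ranks are read off from the
        elements killed by p.\<close>
      have "p ^ group_rank S A \<le> p ^ group_rank S T"
        using card_odd_torsion_le [OF odd_p [OF that, of 1]]
          prime_power_group_rank_subgroup [OF p ord A assms(8)]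
          prime_power_group_rank_subgroup [OF p ord subgroup_T T_comm] by simp
      then show ?thesis using prime_gt_1_nat [OF p] by simp
    qed
    show ?thesis
      unfolding star_eq
    proof (intro conjI impI allI)
      show "derived S B \<subseteq> T" using derived_D D_T by blast
      show "normalizes S T A" "normalizes S A T"
        using conj_N conj_T T_subset_N A_subset_N by (simp_all add: normalizes_def)
      show "b \<in> normalizer_in S (carrier S) T"
        using T_conjugate_b by (simp add: mem_normalizer_T_iff)
      show "?N \<subset> normalizer_in S (carrier S) T"
        using normalizer_psubset by (simp add: N_def)
      assume "p > 2"
      then show "group_exponent S T \<le> group_exponent S A"
        using group_exponent_T_le odd_p ord by simp
      show "lex_ge S p T A" using omega [OF \<open>p > 2\<close>] by (rule lex_ge_if_omega_ge)
      show "group_rank S A \<le> group_rank S T" using \<open>p > 2\<close> by (rule rank)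
      show "omega S p i A \<le> omega S p i T" for i using \<open>p > 2\<close> by (rule omega)
    qed (fact subgroup_T subgroup_mult_conjugate T_subset_mult card_T T_comm A_Int_B_psubset
        T_Int_B_psubset)+
  qed
  ultimately show ?thesis by blast
qed

end
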